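(* Let $\Omega$, $B$, $B^+$, $Z$, $B_Z$, $U_Z$, $C_Z$, $\mathcal{P}_Z$, $G$, $A$, $\phi$ and $\phi^*$ be as in the context. Assume (C) for every $n\in\mathbb{N}$ there exists $z\in\mathbb{R}_+$ such that $n(Z-z)^+-\frac1n\in G-A$. Then the following three conditions are equivalent: (i) there exist no $X\in G-A$ and $\varepsilon\in(0,\infty)$ such that $X\ge\varepsilon$; (ii) there exists $\mathbb{P}\in\mathcal{P}_Z$ such that $\mathbb{E}^{\mathbb{P}}X\le 0$ for all $X\in C_Z\cap(G-A)$; (iii) $\phi$ is real-valued on $B_Z$, $\phi(0)=0$, and $\phi(X)=\max_{\mathbb{P}\in\mathcal{P}_Z}(\mathbb{E}^{\mathbb{P}}X-\phi^*(\mathbb{P}))$ for all $X\in C_Z$ (the supremum being attained). If in addition to (C) one has (U) $\phi(X)=\inf_{Y\in C_Z,\,Y\ge X}\phi(Y)$ for all $X\in U_Z$, then (i)–(iii) are also equivalent to each of the following: (iv) there exists no $X\in G-A$ with $X(\omega)>0$ for all $\omega\in\Omega$; (v) there exists $\mathbb{P}\in\mathcal{P}_Z$ such that $\mathbb{E}^{\mathbb{P}}X\le0$ for all $X\in U_Z\cap(G-A)$; (vi) $\phi$ is real-valued on $B_Z$, $\phi(0)=0$, and $\phi(X)=\max_{\mathbb{P}\in\mathcal{P}_Z}(\mathbb{E}^{\mathbb{P}}X-\phi^*(\mathbb{P}))$ for all $X\in U_Z$.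
   Context: Fix integers $J\ge0$, $T\ge1$. $\Omega$ is a non-empty subset of $((0,\infty)\times\mathbb{R}^J)^T$, endowed with the Euclidean metric. $B$ is the space of all Borel measurable functions $X:\Omega\to\mathbb{R}$ and $B^+=\{X\in B:X\ge0\}$. $Z:\Omega\to[1,\infty)$ is a continuous function such that $\{\omega\in\Omega:Z(\omega)\le z\}$ is compact for every $z\in\mathbb{R}_+$. $B_Z$ is the set of $X\in B$ with $X/Z$ bounded, $U_Z$ the set of upper semicontinuous $X\in B_Z$, $C_Z$ the set of continuous $X\in B_Z$, and $\mathcal{P}_Z$ the set of Borel probability measures $\mathbb{P}$ on $\Omega$ with $\mathbb{E}^{\mathbb{P}}Z<\infty$. $G\subseteq B$ is a set with $0\in G$; $A\subseteq B$ is a set with $B^+\subseteq A$, $A+B^+\subseteq A$, and $A-G=\{a-g:a\in A,g\in G\}$ convex ($G-A$ is defined analogously). For $X\in B$, $\phi(X)=\inf\{m\in\mathbb{R}:m-X\in A-G\}$ with $\inf\emptyset=+\infty$. For $\mathbb{P}\in\mathcal{P}_Z$, $\phi^*(\mathbb{P})=\sup_{X\in C_Z}(\mathbb{E}^{\mathbb{P}}X-\phi(X))$. *)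

theory Defs
  imports "HOL-Probability.Probability"
begin

text \<open>Functions on Omega are represented extensionally: their value outside Omega is
 undefined (extensional Omega). Constants and pointwise operations are restricted to Omega.\<close>

definition cst :: "'a set \<Rightarrow> real \<Rightarrow> ('a \<Rightarrow> real)" where
  "cst \<Omega> m = restrict (\<lambda>_. m) \<Omega>"

definition Bset :: "'a::topological_space set \<Rightarrow> ('a \<Rightarrow> real) set" where
  "Bset \<Omega> = {X. X \<in> borel_measurable (restrict_space borel \<Omega>) \<and> X \<in> extensional \<Omega>}"

definition Bplus :: "'a::topological_space set \<Rightarrow> ('a \<Rightarrow> real) set" where
  "Bplus \<Omega> = {X \<in> Bset \<Omega>. \<forall>\<omega>\<in>\<Omega>. X \<omega> \<ge> 0}"

definition setdiff :: "'a set \<Rightarrow> ('a \<Rightarrow> real) set \<Rightarrow> ('a \<Rightarrow> real) set \<Rightarrow> ('a \<Rightarrow> real) set" where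
  "setdiff \<Omega> S T = {restrict (\<lambda>\<omega>. s \<omega> - t \<omega>) \<Omega> | s t. s \<in> S \<and> t \<in> T}"

definition setsum :: "'a set \<Rightarrow> ('a \<Rightarrow> real) set \<Rightarrow> ('a \<Rightarrow> real) set \<Rightarrow> ('a \<Rightarrow> real) set" where
  "setsum \<Omega> S T = {restrict (\<lambda>\<omega>. s \<omega> + t \<omega>) \<Omega> | s t. s \<in> S \<and> t \<in> T}"

definition fconvex :: "'a set \<Rightarrow> ('a \<Rightarrow> real) set \<Rightarrow> bool" where
  "fconvex \<Omega> S \<longleftrightarrow> (\<forall>x\<in>S. \<forall>y\<in>S. \<forall>t::real. 0 \<le> t \<and> t \<le> 1 \<longrightarrow>
      restrict (\<lambda>\<omega>. t * x \<omega> + (1 - t) * y \<omega>) \<Omega> \<in> S)"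

text \<open>phi(X) = inf {m : m - X in A - G}, with inf of the empty set = +infinity.\<close>
definition phi :: "'a set \<Rightarrow> ('a \<Rightarrow> real) set \<Rightarrow> ('a \<Rightarrow> real) set \<Rightarrow> ('a \<Rightarrow> real) \<Rightarrow> ereal" where
  "phi \<Omega> A G X = Inf (ereal ` {m. restrict (\<lambda>\<omega>. m - X \<omega>) \<Omega> \<in> setdiff \<Omega> A G})"

definition BZ :: "'a::topological_space set \<Rightarrow> ('a \<Rightarrow> real) \<Rightarrow> ('a \<Rightarrow> real) set" where
  "BZ \<Omega> Z = {X \<in> Bset \<Omega>. \<exists>c. \<forall>\<omega>\<in>\<Omega>. \<bar>X \<omega> / Z \<omega>\<bar> \<le> c}"

definition usc_on :: "'a::topological_space set \<Rightarrow> ('a \<Rightarrow> real) \<Rightarrow> bool" where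
  "usc_on \<Omega> X \<longleftrightarrow> (\<forall>c. openin (top_of_set \<Omega>) {\<omega>\<in>\<Omega>. X \<omega> < c})"

definition UZ :: "'a::topological_space set \<Rightarrow> ('a \<Rightarrow> real) \<Rightarrow> ('a \<Rightarrow> real) set" where
  "UZ \<Omega> Z = {X \<in> BZ \<Omega> Z. usc_on \<Omega> X}"

definition CZ :: "'a::topological_space set \<Rightarrow> ('a \<Rightarrow> real) \<Rightarrow> ('a \<Rightarrow> real) set" where
  "CZ \<Omega> Z = {X \<in> BZ \<Omega> Z. continuous_on \<Omega> X}"

definition PZ :: "'a::topological_space set \<Rightarrow> ('a \<Rightarrow> real) \<Rightarrow> 'a measure set" where
  "PZ \<Omega> Z = {P. prob_space P \<and> sets P = sets (restrict_space borel \<Omega>)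
                 \<and> (\<integral>\<^sup>+\<omega>. ennreal (Z \<omega>) \<partial>P) < \<infinity>}"

definition phistar :: "'a::topological_space set \<Rightarrow> ('a \<Rightarrow> real) \<Rightarrow> ('a \<Rightarrow> real) set \<Rightarrow> ('a \<Rightarrow> real) set
    \<Rightarrow> 'a measure \<Rightarrow> ereal" where
  "phistar \<Omega> Z A G P = (SUP X\<in>CZ \<Omega> Z. ereal (integral\<^sup>L P X) - phi \<Omega> A G X)"

definition dual_max :: "'a::topological_space set \<Rightarrow> ('a \<Rightarrow> real) \<Rightarrow> ('a \<Rightarrow> real) set \<Rightarrow> ('a \<Rightarrow> real) set
    \<Rightarrow> ('a \<Rightarrow> real) \<Rightarrow> bool" where
  "dual_max \<Omega> Z A G X \<longleftrightarrow>
     (\<exists>P\<in>PZ \<Omega> Z. phi \<Omega> A G X = ereal (integral\<^sup>L P X) - phistar \<Omega> Z A G P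
        \<and> (\<forall>Q\<in>PZ \<Omega> Z. ereal (integral\<^sup>L Q X) - phistar \<Omega> Z A G Q \<le> phi \<Omega> A G X))"

end

theory Submission
  imports Defs
begin

text \<open>Write \<open>K = A - G\<close>. Then \<open>\<phi>\<close> is convex, increasing and cash-additive, and condition (i) says
  exactly \<open>\<phi> 0 = 0\<close>. In that case \<open>\<phi>\<close> is finite on \<open>B_Z\<close>, since (C) bounds \<open>\<phi> (n Z)\<close>. By Hahn--Banach
  it has a subgradient L at every X. Such an L is positive and normalised, and (C) forces
  \<open>L ((Z - z)\<^sup>+)\<close> to be small for large z; with Dini's theorem on the compact sublevel sets of Z, L has
  the Daniell property on \<open>C_Z\<close> and is integration against some P in \<open>\<P>_Z\<close> there. For continuous X
  this is the dual representation. For upper semicontinuous X the subgradient is taken on all of \<open>B_Z\<close>: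
  X is a pointwise limit of larger \<open>Y\<^sub>n\<close> in \<open>C_Z\<close>, so \<open>L X \<le> E\<^sub>P X\<close>, which replaces a weak compactness
  argument. Finally, if X in \<open>G - A\<close> is positive everywhere, inner regularity gives a compact set
  of positive P-measure on which \<open>X > 1/n\<close>, and the scaled indicator of that set contradicts (v).\<close>

section \<open>Subgradients of convex functionals\<close>

text \<open>A subgradient on the measurable functions is only known to be positive and linear;
  continuity along sequences is gained on the continuous functions, where the compact sublevel sets
  of Z can be used. The factor n in (C) makes this work: a subgradient satisfies L Y <= \<phi> Y + k
  with k independent of Y, and for Y = n (Z - z)^+ the right side stays below 1/n + k while the left
  side carries the factor n. Finiteness of \<phi> from below comes from convexity: were \<phi> X =
  -\<infinity>, averaging an acceptable position against -X with a very cheap one against X would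
  make a negative constant acceptable. Condition (U) enters at one point. The conjugate
  \<open>phistar\<close> tests continuous functions only, so the inequality E_Q X -
  \<open>phistar\<close> Q <= \<phi> X is immediate for continuous X, and (U) transports it to upper
  semicontinuous X; attainment comes from the subgradient in either case. The implications close in
  two cycles: (i), (iii), (ii), (i) and (i), (vi), (v), (iv), (i).\<close>

definition fun_subspace :: "('a \<Rightarrow> real) set \<Rightarrow> bool" where
  "fun_subspace V \<longleftrightarrow> (\<lambda>_. 0) \<in> V \<and> (\<forall>x\<in>V. \<forall>y\<in>V. (\<lambda>w. x w + y w) \<in> V)
     \<and> (\<forall>x\<in>V. \<forall>a. (\<lambda>w. a * x w) \<in> V)"

definition fun_linear_on :: "('a \<Rightarrow> real) set \<Rightarrow> (('a \<Rightarrow> real) \<Rightarrow> real) \<Rightarrow> bool" where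
  "fun_linear_on V L \<longleftrightarrow> (\<forall>x\<in>V. \<forall>y\<in>V. L (\<lambda>w. x w + y w) = L x + L y)
     \<and> (\<forall>x\<in>V. \<forall>a. L (\<lambda>w. a * x w) = a * L x)"

definition fun_sublinear_on :: "('a \<Rightarrow> real) set \<Rightarrow> (('a \<Rightarrow> real) \<Rightarrow> real) \<Rightarrow> bool" where
  "fun_sublinear_on V p \<longleftrightarrow> (\<forall>x\<in>V. \<forall>y\<in>V. p (\<lambda>w. x w + y w) \<le> p x + p y)
     \<and> (\<forall>x\<in>V. \<forall>a\<ge>0. p (\<lambda>w. a * x w) = a * p x)"

definition fun_convex_on :: "('a \<Rightarrow> real) set \<Rightarrow> (('a \<Rightarrow> real) \<Rightarrow> real) \<Rightarrow> bool" where
  "fun_convex_on V f \<longleftrightarrow> (\<forall>x\<in>V. \<forall>y\<in>V. \<forall>t. 0 \<le> t \<longrightarrow> t \<le> 1 \<longrightarrow>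
     f (\<lambda>w. t * x w + (1 - t) * y w) \<le> t * f x + (1 - t) * f y)"

lemma
  assumes "fun_subspace V"
  shows fun_subspace_zero: "(\<lambda>_. 0) \<in> V"
    and fun_subspace_add: "x \<in> V \<Longrightarrow> y \<in> V \<Longrightarrow> (\<lambda>w. x w + y w) \<in> V"
    and fun_subspace_scale: "x \<in> V \<Longrightarrow> (\<lambda>w. a * x w) \<in> V"
  using assms by (simp_all add: fun_subspace_def)

lemma
  assumes "fun_linear_on V L"
  shows fun_linear_add: "x \<in> V \<Longrightarrow> y \<in> V \<Longrightarrow> L (\<lambda>w. x w + y w) = L x + L y"
    and fun_linear_scale: "x \<in> V \<Longrightarrow> L (\<lambda>w. a * x w) = a * L x"
  using assms by (simp_all add: fun_linear_on_def)

lemma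
  assumes "fun_sublinear_on V p"
  shows fun_sublinear_add: "x \<in> V \<Longrightarrow> y \<in> V \<Longrightarrow> p (\<lambda>w. x w + y w) \<le> p x + p y"
    and fun_sublinear_scale: "x \<in> V \<Longrightarrow> a \<ge> 0 \<Longrightarrow> p (\<lambda>w. a * x w) = a * p x"
  using assms by (simp_all add: fun_sublinear_on_def)

lemma fun_convex_onD:
  assumes "fun_convex_on V f" "x \<in> V" "y \<in> V" "0 \<le> t" "t \<le> 1"
  shows "f (\<lambda>w. t * x w + (1 - t) * y w) \<le> t * f x + (1 - t) * f y"
  using assms by (simp add: fun_convex_on_def)

lemma fun_subspace_lincomb:
  assumes "fun_subspace V" "x \<in> V" "y \<in> V"
  shows "(\<lambda>w. a * x w + b * y w) \<in> V"
  using assms by (intro fun_subspace_add fun_subspace_scale)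

lemma fun_subspace_diff:
  assumes "fun_subspace V" "x \<in> V" "y \<in> V"
  shows "(\<lambda>w. x w - y w) \<in> V"
  using fun_subspace_lincomb[OF assms, of 1 "-1"] by simp

lemma fun_subspace_minus:
  assumes "fun_subspace V" "x \<in> V"
  shows "(\<lambda>w. - x w) \<in> V"
  using fun_subspace_lincomb[OF assms assms(2), of "-1" 0] by simp

lemma fun_sublinear_zero:
  assumes "fun_subspace V" "fun_sublinear_on V p"
  shows "p (\<lambda>_. 0) = 0"
proof -
  have "p (\<lambda>w. 0 * (\<lambda>_. 0) w) = 0 * p (\<lambda>_. 0)"
    by (rule fun_sublinear_scale[OF assms(2) fun_subspace_zero[OF assms(1)]]) simp
  then show ?thesis by simp
qed

lemma fun_sublinear_minus_le:
  assumes "fun_subspace V" "fun_sublinear_on V p" "x \<in> V"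
  shows "- p (\<lambda>w. - x w) \<le> p x"
proof -
  have "p (\<lambda>w. x w + (- x w)) \<le> p x + p (\<lambda>w. - x w)"
    by (rule fun_sublinear_add[OF assms(2,3) fun_subspace_minus[OF assms(1,3)]])
  then show ?thesis using fun_sublinear_zero[OF assms(1,2)] by simp
qed

text \<open>This supplies the bounds needed for Zorn's lemma. Every sublinear q below p satisfies
  -p(-x) <= q x, so the infimum is finite. Subadditivity uses comparability in the chain: in q x + r
  y both functionals may be replaced by the smaller one.\<close>

lemma fun_sublinear_chain_Inf:
  assumes V: "fun_subspace V" and ne: "C \<noteq> {}"
    and sub: "\<forall>q\<in>C. fun_sublinear_on V q"
    and below: "\<forall>q\<in>C. \<forall>x\<in>V. q x \<le> p x"
    and chain: "\<forall>q\<in>C. \<forall>r\<in>C. (\<forall>x\<in>V. q x \<le> r x) \<or> (\<forall>x\<in>V. r x \<le> q x)"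
  shows "fun_sublinear_on V (\<lambda>x. INF q\<in>C. q x)"
    and "\<And>q x. q \<in> C \<Longrightarrow> x \<in> V \<Longrightarrow> (INF q\<in>C. q x) \<le> q x"
proof -
  have lower: "- p (\<lambda>w. - x w) \<le> q x" if q: "q \<in> C" and x: "x \<in> V" for q x
  proof -
    have "- p (\<lambda>w. - x w) \<le> - q (\<lambda>w. - x w)"
      using below q fun_subspace_minus[OF V x] by simp
    also have "\<dots> \<le> q x" by (rule fun_sublinear_minus_le[OF V sub[rule_format, OF q] x])
    finally show "- p (\<lambda>w. - x w) \<le> q x" .
  qed
  have bdd: "bdd_below ((\<lambda>q. q x) ` C)" if "x \<in> V" for x
    by (rule bdd_belowI2[of _ "- p (\<lambda>w. - x w)"]) (use lower that in auto)
  show le: "(INF q\<in>C. q x) \<le> q x" if "q \<in> C" "x \<in> V" for q x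
    by (rule cINF_lower[OF bdd that(1)]) (rule that)
  show "fun_sublinear_on V (\<lambda>x. INF q\<in>C. q x)"
    unfolding fun_sublinear_on_def
  proof (intro conjI ballI allI impI)
    fix x y assume xy: "x \<in> V" "y \<in> V"
    then have s: "(\<lambda>w. x w + y w) \<in> V" by (intro fun_subspace_add[OF V])
    have *: "(INF q\<in>C. q (\<lambda>w. x w + y w)) \<le> q x + r y" if q: "q \<in> C" and r: "r \<in> C" for q r
    proof (cases "\<forall>x\<in>V. q x \<le> r x")
      case True
      have "(INF q\<in>C. q (\<lambda>w. x w + y w)) \<le> q (\<lambda>w. x w + y w)" by (rule le[OF q s])
      also have "\<dots> \<le> q x + q y" by (rule fun_sublinear_add[OF sub[rule_format, OF q] xy])
      also have "\<dots> \<le> q x + r y" using True xy by auto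
      finally show ?thesis .
    next
      case False
      with chain q r have F: "\<forall>x\<in>V. r x \<le> q x" by auto
      have "(INF q\<in>C. q (\<lambda>w. x w + y w)) \<le> r (\<lambda>w. x w + y w)" by (rule le[OF r s])
      also have "\<dots> \<le> r x + r y" by (rule fun_sublinear_add[OF sub[rule_format, OF r] xy])
      also have "\<dots> \<le> q x + r y" using F xy by auto
      finally show ?thesis .
    qed
    let ?I = "INF q\<in>C. q (\<lambda>w. x w + y w)"
    have "?I - r y \<le> (INF q\<in>C. q x)" if r: "r \<in> C" for r
    proof (rule cINF_greatest[OF ne])
      fix q assume "q \<in> C"
      from *[OF this r] show "?I - r y \<le> q x" by linarith
    qed
    then have "?I - (INF q\<in>C. q x) \<le> (INF q\<in>C. q y)"
      by (intro cINF_greatest[OF ne]) (smt (verit))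
    then show "?I \<le> (INF q\<in>C. q x) + (INF q\<in>C. q y)" by linarith
  next
    fix x a assume x: "x \<in> V" and a: "(0::real) \<le> a"
    have "(INF q\<in>C. q (\<lambda>w. a * x w)) = (INF q\<in>C. a * q x)"
      using sub x a by (intro INF_cong refl fun_sublinear_scale[of V]) auto
    also have "\<dots> = a * (INF q\<in>C. q x)"
    proof (cases "a = 0")
      case True
      then show ?thesis using ne by simp
    next
      case False
      with a have a: "a > 0" by simp
      show ?thesis
      proof (rule antisym)
        have "(INF q\<in>C. a * q x) / a \<le> (INF q\<in>C. q x)"
        proof (rule cINF_greatest[OF ne])
          fix q assume q: "q \<in> C"
          have "bdd_below ((\<lambda>q. a * q x) ` C)"
            by (rule bdd_belowI2[of _ "a * - p (\<lambda>w. - x w)"])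
              (intro mult_left_mono lower x less_imp_le[OF a])
          from cINF_lower[OF this q] show "(INF q\<in>C. a * q x) / a \<le> q x"
            using a by (simp add: field_simps)
        qed
        then show "(INF q\<in>C. a * q x) \<le> a * (INF q\<in>C. q x)" using a by (simp add: field_simps)
        show "a * (INF q\<in>C. q x) \<le> (INF q\<in>C. a * q x)"
          using a le x by (intro cINF_greatest[OF ne]) auto
      qed
    qed
    finally show "(INF q\<in>C. q (\<lambda>w. a * x w)) = a * (INF q\<in>C. q x)" .
  qed
qed

lemma fun_sublinear_minimal_exists:
  assumes V: "fun_subspace V" and p: "fun_sublinear_on V p"
  shows "\<exists>q. fun_sublinear_on V q \<and> (\<forall>x\<in>V. q x \<le> p x) \<and>
    (\<forall>r. fun_sublinear_on V r \<longrightarrow> (\<forall>x\<in>V. r x \<le> q x) \<longrightarrow> (\<forall>x\<in>V. r x = q x))"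
proof -
  \<comment> \<open>Values off V are fixed by extensionality, since otherwise comparison on V would
    not be antisymmetric.\<close>
  define S where "S = {q \<in> extensional V. fun_sublinear_on V q \<and> (\<forall>x\<in>V. q x \<le> p x)}"
  \<comment> \<open>The order is reversed, so a maximal element in Zorn's sense is a minimal
    sublinear functional.\<close>
  define R where "R = (\<lambda>q r :: ('a \<Rightarrow> real) \<Rightarrow> real. \<forall>x\<in>V. r x \<le> q x)"
  have restr: "fun_sublinear_on V (restrict q V)" if "fun_sublinear_on V q" for q
    using that V unfolding fun_sublinear_on_def fun_subspace_def by simp
  have po: "partial_order_on S (relation_of R S)"
  proof (rule partial_order_on_relation_ofI)
    show "R a a" for a by (simp add: R_def)
    show "R a c" if "R a b" "R b c" for a b c using that unfolding R_def by fastforce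
    show "a = b" if "a \<in> S" "b \<in> S" "R a b" "R b a" for a b
    proof (rule extensionalityI)
      show "a \<in> extensional V" "b \<in> extensional V" using that S_def by auto
      show "a x = b x" if "x \<in> V" for x
        using \<open>R a b\<close> \<open>R b a\<close> that unfolding R_def by (simp add: antisym)
    qed
  qed
  have "\<exists>m\<in>S. \<forall>a\<in>S. R m a \<longrightarrow> a = m"
  proof (rule predicate_Zorn[OF po])
    fix C assume C: "C \<in> Chains (relation_of R S)"
    then have CS: "C \<subseteq> S" and tot: "\<And>q r. q \<in> C \<Longrightarrow> r \<in> C \<Longrightarrow> R q r \<or> R r q"
      unfolding Chains_def relation_of_def by auto
    show "\<exists>u\<in>S. \<forall>a\<in>C. R a u"
    proof (cases "C = {}")
      case True
      have "restrict p V \<in> S" unfolding S_def using restr[OF p] by simp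
      with True show ?thesis by blast
    next
      case False
      have 1: "\<forall>q\<in>C. fun_sublinear_on V q" using CS unfolding S_def by auto
      have 2: "\<forall>q\<in>C. \<forall>x\<in>V. q x \<le> p x" using CS unfolding S_def by auto
      have 3: "\<forall>q\<in>C. \<forall>r\<in>C. (\<forall>x\<in>V. q x \<le> r x) \<or> (\<forall>x\<in>V. r x \<le> q x)"
        using tot unfolding R_def by blast
      note I = fun_sublinear_chain_Inf[OF V False 1 2 3]
      define u where "u = restrict (\<lambda>x. INF q\<in>C. q x) V"
      have "fun_sublinear_on V u" unfolding u_def by (rule restr) (rule I(1))
      moreover have le: "u x \<le> q x" if "q \<in> C" "x \<in> V" for q x
        using I(2)[of q x] that by (simp add: u_def)
      moreover have "u x \<le> p x" if "x \<in> V" for x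
        using False le 2 that by (metis all_not_in_conv order_trans)
      ultimately have "u \<in> S" unfolding S_def by (simp add: u_def)
      then show ?thesis using le unfolding R_def by blast
    qed
  qed
  then obtain m where m: "m \<in> S" and min: "\<And>a. a \<in> S \<Longrightarrow> R m a \<Longrightarrow> a = m" by blast
  show ?thesis
  proof (intro exI conjI)
    show "fun_sublinear_on V m" using m S_def by simp
    show mp: "\<forall>x\<in>V. m x \<le> p x" using m S_def by simp
    have "r x = m x" if r: "fun_sublinear_on V r" "\<forall>x\<in>V. r x \<le> m x" and x: "x \<in> V" for r x
    proof -
    have "restrict r V \<in> S" using restr[OF r(1)] r(2) mp unfolding S_def
      by (fastforce intro: order_trans)
    moreover have "R m (restrict r V)" using r(2) by (simp add: R_def)
    ultimately have "restrict r V = m" by (rule min)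
    then show "r x = m x" using x by (metis restrict_apply')
    qed
    then show "\<forall>r. fun_sublinear_on V r \<longrightarrow> (\<forall>x\<in>V. r x \<le> m x) \<longrightarrow> (\<forall>x\<in>V. r x = m x)" by simp
  qed
qed

text \<open>A minimal sublinear functional q is linear: its modification
  \<open>x \<mapsto> inf {q (x + t y) - t q y | t \<ge> 0}\<close> is sublinear and dominated by q, hence equal to q,
  and \<open>t = 1\<close>, \<open>x = - y\<close> gives \<open>q (- y) \<le> - q y\<close>.\<close>

lemma hahn_banach_dominated:
  assumes V: "fun_subspace V" and p: "fun_sublinear_on V p"
  shows "\<exists>L. fun_linear_on V L \<and> (\<forall>x\<in>V. L x \<le> p x)"
proof -
  obtain q where q: "fun_sublinear_on V q" and qp: "\<forall>x\<in>V. q x \<le> p x"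
    and min: "\<forall>r. fun_sublinear_on V r \<longrightarrow> (\<forall>x\<in>V. r x \<le> q x) \<longrightarrow> (\<forall>x\<in>V. r x = q x)"
    using fun_sublinear_minimal_exists[OF V p] by blast
  have qadd: "q (\<lambda>w. x w + y w) \<le> q x + q y" if "x \<in> V" "y \<in> V" for x y
    by (rule fun_sublinear_add[OF q that])
  have qscale: "q (\<lambda>w. a * x w) = a * q x" if "x \<in> V" "a \<ge> 0" for x a
    by (rule fun_sublinear_scale[OF q that])
  have q0: "q (\<lambda>_. 0) = 0" by (rule fun_sublinear_zero[OF V q])
  have lc: "(\<lambda>w. x w + t * y w) \<in> V" if "x \<in> V" "y \<in> V" for x y t
    using fun_subspace_lincomb[OF V that, of 1 t] by simp
  have neg: "q (\<lambda>w. - y w) = - q y" if y: "y \<in> V" for y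
  proof -
    define r where "r x = (INF t\<in>{0..}. q (\<lambda>w. x w + t * y w) - t * q y)" for x
    \<comment> \<open>The functions x + t y and -x add up to t y; subadditivity and homogeneity thus
      bound the infimum from below, uniformly in t.\<close>
    have lb: "- q (\<lambda>w. - x w) \<le> q (\<lambda>w. x w + t * y w) - t * q y" if x: "x \<in> V" and t: "t \<ge> 0" for x t
      using qadd[OF lc[OF x y, of t] fun_subspace_minus[OF V x]] qscale[OF y t] by simp
    have bdd: "bdd_below ((\<lambda>t. q (\<lambda>w. x w + t * y w) - t * q y) ` {0..})" if "x \<in> V" for x
      by (rule bdd_belowI2[of _ "- q (\<lambda>w. - x w)"]) (use lb[OF that] in auto)
    have rle: "r x \<le> q (\<lambda>w. x w + t * y w) - t * q y" if "x \<in> V" "t \<ge> 0" for x t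
      unfolding r_def by (rule cINF_lower[OF bdd[OF that(1)]]) (use that in simp)
    have "r x \<le> q x" if "x \<in> V" for x using rle[OF that, of 0] by simp
    moreover have "fun_sublinear_on V r"
      unfolding fun_sublinear_on_def
    proof (intro conjI ballI allI impI)
      fix x z assume xz: "x \<in> V" "z \<in> V"
      then have s: "(\<lambda>w. x w + z w) \<in> V" by (intro fun_subspace_add[OF V])
      have *: "r (\<lambda>w. x w + z w) \<le> (q (\<lambda>w. x w + t * y w) - t * q y) + (q (\<lambda>w. z w + u * y w) - u * q y)"
        if "t \<ge> 0" "u \<ge> 0" for t u
      proof -
        have "r (\<lambda>w. x w + z w) \<le> q (\<lambda>w. (x w + z w) + (t + u) * y w) - (t + u) * q y"
          using rle[OF s, of "t + u"] that by simp
        moreover have "q (\<lambda>w. (x w + z w) + (t + u) * y w) \<le> q (\<lambda>w. x w + t * y w) + q (\<lambda>w. z w + u * y w)"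
          using qadd[OF lc[OF xz(1) y, of t] lc[OF xz(2) y, of u]] by (simp add: algebra_simps)
        ultimately show ?thesis by (simp add: algebra_simps)
      qed
      have "r (\<lambda>w. x w + z w) - (q (\<lambda>w. z w + u * y w) - u * q y) \<le> r x" if "u \<ge> 0" for u
        unfolding r_def[of x] by (rule cINF_greatest) (use *[OF _ that] in \<open>auto simp: algebra_simps\<close>)
      then have "r (\<lambda>w. x w + z w) - r x \<le> r z"
        unfolding r_def[of z] by (intro cINF_greatest) (auto simp: algebra_simps)
      then show "r (\<lambda>w. x w + z w) \<le> r x + r z" by linarith
    next
      fix x a assume x: "x \<in> V" and a: "(0::real) \<le> a"
      show "r (\<lambda>w. a * x w) = a * r x"
      proof (cases "a = 0")
        case True
        have "r (\<lambda>_. 0) = 0"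
        proof -
          have "(INF t\<in>{0..}. q (\<lambda>w. 0 + t * y w) - t * q y) = (INF t\<in>{0::real..}. 0)"
            by (rule INF_cong) (use qscale[OF y] in auto)
          then show ?thesis unfolding r_def by simp
        qed
        then show ?thesis using True by simp
      next
        case False
        with a have a: "a > 0" by simp
        have ax: "(\<lambda>w. a * x w) \<in> V" by (intro fun_subspace_scale[OF V x])
        \<comment> \<open>By homogeneity, scaling x by a amounts to replacing the parameter t by t/a
          in the infimum.\<close>
        have eq: "q (\<lambda>w. a * x w + t * y w) - t * q y = a * (q (\<lambda>w. x w + (t / a) * y w) - (t / a) * q y)"
          for t using qscale[OF lc[OF x y, of "t / a"], of a] a by (simp add: algebra_simps)
        show ?thesis
        proof (rule antisym)
          have "r (\<lambda>w. a * x w) / a \<le> r x"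
            unfolding r_def[of x]
          proof (rule cINF_greatest)
            fix t :: real assume "t \<in> {0..}"
            with rle[OF ax, of "a * t"] a eq[of "a * t"]
            have "r (\<lambda>w. a * x w) \<le> a * (q (\<lambda>w. x w + t * y w) - t * q y)" by simp
            then show "r (\<lambda>w. a * x w) / a \<le> q (\<lambda>w. x w + t * y w) - t * q y"
              using a by (simp add: field_simps)
          qed simp
          then show "r (\<lambda>w. a * x w) \<le> a * r x" using a by (simp add: field_simps)
          show "a * r x \<le> r (\<lambda>w. a * x w)"
            unfolding r_def[of "\<lambda>w. a * x w"]
          proof (rule cINF_greatest)
            fix t :: real assume "t \<in> {0..}"
            then show "a * r x \<le> q (\<lambda>w. a * x w + t * y w) - t * q y"
              unfolding eq using a rle[OF x, of "t / a"] by (intro mult_left_mono) auto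
          qed simp
        qed
      qed
    qed
    ultimately have "r (\<lambda>w. - y w) = q (\<lambda>w. - y w)"
      using min fun_subspace_minus[OF V y] by simp
    moreover have "r (\<lambda>w. - y w) \<le> - q y"
      using rle[OF fun_subspace_minus[OF V y], of 1] q0 by simp
    ultimately show ?thesis using fun_sublinear_minus_le[OF V q y] by linarith
  qed
  \<comment> \<open>Once q (-y) = -q y, subadditivity applied to (x + y) + (-y) gives the missing
    half of additivity.\<close>
  have "fun_linear_on V q"
    unfolding fun_linear_on_def
  proof (intro conjI ballI allI)
    fix x y assume xy: "x \<in> V" "y \<in> V"
    then have s: "(\<lambda>w. x w + y w) \<in> V" by (intro fun_subspace_add[OF V])
    have "q (\<lambda>w. (x w + y w) + (- y w)) \<le> q (\<lambda>w. x w + y w) + q (\<lambda>w. - y w)"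
      by (rule qadd[OF s fun_subspace_minus[OF V xy(2)]])
    then show "q (\<lambda>w. x w + y w) = q x + q y" using qadd[OF xy] neg[OF xy(2)] by simp
  next
    fix x a assume x: "x \<in> V"
    show "q (\<lambda>w. a * x w) = a * q x"
    proof (cases "a \<ge> 0")
      case False
      have "(\<lambda>w. - a * x w) \<in> V" by (intro fun_subspace_scale[OF V x])
      from neg[OF this] have "q (\<lambda>w. a * x w) = - q (\<lambda>w. - a * x w)" by simp
      then show ?thesis using qscale[OF x, of "- a"] False by simp
    qed (rule qscale[OF x])
  qed
  then show ?thesis using qp by blast
qed

text \<open>Apply the previous lemma to the one-sided directional derivative of f at x.\<close>

lemma fun_convex_subgradient:
  assumes V: "fun_subspace V" and f: "fun_convex_on V f" and x: "x \<in> V"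
  shows "\<exists>L. fun_linear_on V L \<and> (\<forall>y\<in>V. L y \<le> f (\<lambda>w. x w + y w) - f x)"
proof -
  define p where "p y = (INF t\<in>{0<..}. (f (\<lambda>w. x w + t * y w) - f x) / t)" for y
  have conv: "f (\<lambda>w. t * u w + (1 - t) * v w) \<le> t * f u + (1 - t) * f v"
    if "u \<in> V" "v \<in> V" "0 \<le> t" "t \<le> 1" for u v t
    by (rule fun_convex_onD[OF f that])
  have lc: "(\<lambda>w. x w + t * y w) \<in> V" if "y \<in> V" for y t
    using fun_subspace_lincomb[OF V x that, of 1 t] by simp
  \<comment> \<open>The point x lies on the segment from x + t y to x - y, with weight s = 1/(1+t)
    on the former. Convexity there shows that the difference quotients are bounded below by the
    backward quotient of step 1.\<close>
  have lb: "f x - f (\<lambda>w. x w + (-1) * y w) \<le> (f (\<lambda>w. x w + t * y w) - f x) / t"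
    if y: "y \<in> V" and t: "t > 0" for y t
  proof -
    define s where "s = 1 / (1 + t)"
    have s: "0 \<le> s" "s \<le> 1" "s * (1 + t) = 1" "1 - s = s * t" using t by (auto simp: s_def field_simps)
    have "s * (x w + t * y w) + (1 - s) * (x w + (-1) * y w) = x w" for w
    proof -
      have "s * (x w + t * y w) + s * t * (x w + (-1) * y w) = (s * (1 + t)) * x w"
        by (simp add: algebra_simps)
      then show ?thesis unfolding s(3,4) by simp
    qed
    with conv[OF lc[OF y, of t] lc[OF y, of "-1"] s(1,2)]
    have "f x \<le> s * f (\<lambda>w. x w + t * y w) + s * t * f (\<lambda>w. x w + (-1) * y w)" using s(4) by simp
    from mult_left_mono[OF this, of "1 + t"] t
    have "(1 + t) * f x \<le> (s * (1 + t)) * f (\<lambda>w. x w + t * y w) + (s * (1 + t)) * (t * f (\<lambda>w. x w + (-1) * y w))"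
      by (simp add: algebra_simps)
    then have "(1 + t) * f x \<le> f (\<lambda>w. x w + t * y w) + t * f (\<lambda>w. x w + (-1) * y w)"
      unfolding s(3) by simp
    then show ?thesis using t by (simp add: field_simps)
  qed
  have bdd: "bdd_below ((\<lambda>t. (f (\<lambda>w. x w + t * y w) - f x) / t) ` {0<..})" if "y \<in> V" for y
    by (rule bdd_belowI2) (use lb[OF that] in auto)
  have ple: "p y \<le> (f (\<lambda>w. x w + t * y w) - f x) / t" if "y \<in> V" "t > 0" for y t
    unfolding p_def by (rule cINF_lower[OF bdd[OF that(1)]]) (use that in simp)
  have "fun_sublinear_on V p"
    unfolding fun_sublinear_on_def
  proof (intro conjI ballI allI impI)
    fix y z assume yz: "y \<in> V" "z \<in> V"
    then have s: "(\<lambda>w. y w + z w) \<in> V" by (intro fun_subspace_add[OF V])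
    have *: "p (\<lambda>w. y w + z w) \<le> (f (\<lambda>w. x w + t * y w) - f x) / t + (f (\<lambda>w. x w + u * z w) - f x) / u"
      if t: "t > 0" and u: "u > 0" for t u
    proof -
      \<comment> \<open>The weights c and 1 - c are chosen so that both steps acquire the same
        length: c t = (1 - c) u = d. The convex combination is then a single step d in the direction
        y + z.\<close>
      define c where "c = u / (t + u)"
      define d where "d = t * u / (t + u)"
      have c: "0 \<le> c" "c \<le> 1" "c * t = d" "(1 - c) * u = d" "d > 0" "c / d = 1 / t" "(1 - c) / d = 1 / u"
      proof -
        have n: "t + u \<noteq> 0" "t \<noteq> 0" "u \<noteq> 0" using t u by auto
        have "1 - c = t / (t + u)" using n by (simp add: c_def field_simps)
        then show "0 \<le> c" "c \<le> 1" "c * t = d" "(1 - c) * u = d" "d > 0" "c / d = 1 / t" "(1 - c) / d = 1 / u"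
          using n t u by (simp_all add: c_def d_def)
      qed
      have "c * (x w + t * y w) + (1 - c) * (x w + u * z w) = x w + (c * t) * y w + ((1 - c) * u) * z w" for w
        by (simp add: algebra_simps)
      then have "c * (x w + t * y w) + (1 - c) * (x w + u * z w) = x w + d * (y w + z w)" for w
        unfolding c by (simp add: algebra_simps)
      with conv[OF lc[OF yz(1), of t] lc[OF yz(2), of u] c(1,2)]
      have "f (\<lambda>w. x w + d * (y w + z w)) - f x \<le> c * (f (\<lambda>w. x w + t * y w) - f x) + (1 - c) * (f (\<lambda>w. x w + u * z w) - f x)"
        by (simp add: algebra_simps)
      then have "(f (\<lambda>w. x w + d * (y w + z w)) - f x) / d
        \<le> (c * (f (\<lambda>w. x w + t * y w) - f x) + (1 - c) * (f (\<lambda>w. x w + u * z w) - f x)) / d"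
        using c(5) by (intro divide_right_mono) auto
      also have "\<dots> = (c / d) * (f (\<lambda>w. x w + t * y w) - f x) + ((1 - c) / d) * (f (\<lambda>w. x w + u * z w) - f x)"
        by (simp add: add_divide_distrib)
      finally show ?thesis using ple[OF s c(5)] unfolding c by simp
    qed
    have "p (\<lambda>w. y w + z w) - (f (\<lambda>w. x w + u * z w) - f x) / u \<le> p y" if "u > 0" for u
      unfolding p_def[of y] by (rule cINF_greatest) (use *[OF _ that] in \<open>auto simp: algebra_simps\<close>)
    then have "p (\<lambda>w. y w + z w) - p y \<le> p z"
      unfolding p_def[of z] by (intro cINF_greatest) (auto simp: algebra_simps)
    then show "p (\<lambda>w. y w + z w) \<le> p y + p z" by linarith
  next
    fix y a assume y: "y \<in> V" and a: "(0::real) \<le> a"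
    show "p (\<lambda>w. a * y w) = a * p y"
    proof (cases "a = 0")
      case True
      then show ?thesis by (simp add: p_def)
    next
      case False
      with a have a: "a > 0" by simp
      have ay: "(\<lambda>w. a * y w) \<in> V" by (intro fun_subspace_scale[OF V y])
      show ?thesis
      proof (rule antisym)
        have "p (\<lambda>w. a * y w) / a \<le> p y"
          unfolding p_def[of y]
        proof (rule cINF_greatest)
          fix t :: real assume "t \<in> {0<..}"
          then show "p (\<lambda>w. a * y w) / a \<le> (f (\<lambda>w. x w + t * y w) - f x) / t"
            using ple[OF ay, of "t / a"] a by (simp add: field_simps)
        qed simp
        then show "p (\<lambda>w. a * y w) \<le> a * p y" using a by (simp add: field_simps)
        show "a * p y \<le> p (\<lambda>w. a * y w)"
          unfolding p_def[of "\<lambda>w. a * y w"]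
        proof (rule cINF_greatest)
          fix t :: real assume "t \<in> {0<..}"
          then show "a * p y \<le> (f (\<lambda>w. x w + t * (a * y w)) - f x) / t"
            using ple[OF y, of "a * t"] a by (simp add: field_simps)
        qed simp
      qed
    qed
  qed
  then obtain L where L: "fun_linear_on V L" "\<forall>y\<in>V. L y \<le> p y"
    using hahn_banach_dominated[OF V] by blast
  \<comment> \<open>The directional derivative is an infimum of difference quotients; the quotient
    at t = 1 gives the subgradient inequality.\<close>
  have "L y \<le> f (\<lambda>w. x w + y w) - f x" if "y \<in> V" for y
    using L(2) that ple[OF that, of 1] by fastforce
  with L(1) show ?thesis by blast
qed

section \<open>Functions of growth Z\<close>

text \<open>The type is Polish because finite Borel measures are then inner regular with respect to
  compact sets.\<close>

locale weighted_space =
  fixes \<Omega> :: "'a::polish_space set" and Z :: "'a \<Rightarrow> real"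
  assumes Omega_ne: "\<Omega> \<noteq> {}"
    and Z_cont: "continuous_on \<Omega> Z"
    and Z_ge1: "\<forall>\<omega>\<in>\<Omega>. Z \<omega> \<ge> 1"
    and Z_compact: "\<forall>z\<ge>0. compact {\<omega>\<in>\<Omega>. Z \<omega> \<le> z}"
begin

text \<open>Unlike \<^term>\<open>CZ \<Omega> Z\<close> and \<^term>\<open>BZ \<Omega> Z\<close>, the following spaces put no condition on the
  values outside \<^term>\<open>\<Omega>\<close>, so that they are closed under pointwise operations.\<close>

definition VC :: "('a \<Rightarrow> real) set" where
  "VC = {f. continuous_on \<Omega> f \<and> (\<exists>c. \<forall>\<omega>\<in>\<Omega>. \<bar>f \<omega>\<bar> \<le> c * Z \<omega>)}"

definition VB :: "('a \<Rightarrow> real) set" where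
  "VB = {f \<in> borel_measurable (restrict_space borel \<Omega>). \<exists>c. \<forall>\<omega>\<in>\<Omega>. \<bar>f \<omega>\<bar> \<le> c * Z \<omega>}"

lemma growth_add:
  assumes "\<exists>c. \<forall>\<omega>\<in>\<Omega>. \<bar>f \<omega>\<bar> \<le> c * Z \<omega>" "\<exists>c. \<forall>\<omega>\<in>\<Omega>. \<bar>g \<omega>\<bar> \<le> c * Z \<omega>"
  shows "\<exists>c. \<forall>\<omega>\<in>\<Omega>. \<bar>f \<omega> + g \<omega>\<bar> \<le> c * Z \<omega>"
proof -
  obtain c d where "\<And>\<omega>. \<omega> \<in> \<Omega> \<Longrightarrow> \<bar>f \<omega>\<bar> \<le> c * Z \<omega>" "\<And>\<omega>. \<omega> \<in> \<Omega> \<Longrightarrow> \<bar>g \<omega>\<bar> \<le> d * Z \<omega>"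
    using assms by auto
  then have "\<bar>f \<omega> + g \<omega>\<bar> \<le> (c + d) * Z \<omega>" if "\<omega> \<in> \<Omega>" for \<omega>
    using that by (smt (verit) distrib_right)
  then show ?thesis by blast
qed

lemma growth_scale:
  assumes "\<exists>c. \<forall>\<omega>\<in>\<Omega>. \<bar>f \<omega>\<bar> \<le> c * Z \<omega>"
  shows "\<exists>c. \<forall>\<omega>\<in>\<Omega>. \<bar>a * f \<omega>\<bar> \<le> c * Z \<omega>"
proof -
  obtain c where "\<And>\<omega>. \<omega> \<in> \<Omega> \<Longrightarrow> \<bar>f \<omega>\<bar> \<le> c * Z \<omega>" using assms by auto
  then have "\<bar>a * f \<omega>\<bar> \<le> (\<bar>a\<bar> * c) * Z \<omega>" if "\<omega> \<in> \<Omega>" for \<omega>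
    using mult_left_mono[of "\<bar>f \<omega>\<bar>" "c * Z \<omega>" "\<bar>a\<bar>"] that by (simp add: abs_mult mult.assoc)
  then show ?thesis by blast
qed

lemma growth_const: "\<exists>c. \<forall>\<omega>\<in>\<Omega>. \<bar>m\<bar> \<le> c * Z \<omega>"
proof -
  have "\<bar>m\<bar> \<le> \<bar>m\<bar> * Z \<omega>" if "\<omega> \<in> \<Omega>" for \<omega>
    using mult_left_mono[of 1 "Z \<omega>" "\<bar>m\<bar>"] Z_ge1 that by simp
  then show ?thesis by blast
qed

lemma VC_subspace: "fun_subspace VC"
  unfolding fun_subspace_def VC_def
  using growth_add growth_scale growth_const[of 0] by (auto intro!: continuous_intros)

lemma VB_subspace: "fun_subspace VB"
  unfolding fun_subspace_def VB_def
  using growth_add growth_scale growth_const[of 0] by (auto intro!: borel_measurable_add borel_measurable_times)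

lemma VC_subset_VB: "VC \<subseteq> VB"
  by (auto simp: VC_def VB_def intro: borel_measurable_continuous_on_restrict)

lemmas VC_intros = fun_subspace_add[OF VC_subspace] fun_subspace_scale[OF VC_subspace]
  fun_subspace_diff[OF VC_subspace] fun_subspace_minus[OF VC_subspace]

lemmas VB_intros = fun_subspace_add[OF VB_subspace] fun_subspace_scale[OF VB_subspace]
  fun_subspace_diff[OF VB_subspace] fun_subspace_minus[OF VB_subspace]

lemma VC_const: "(\<lambda>_. m) \<in> VC"
  using growth_const[of m] by (auto simp: VC_def)

lemma VC_Z: "Z \<in> VC"
proof -
  have "\<bar>Z \<omega>\<bar> \<le> 1 * Z \<omega>" if "\<omega> \<in> \<Omega>" for \<omega> using Z_ge1 that by fastforce
  then show ?thesis unfolding VC_def using Z_cont by blast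
qed

lemma VC_abs_le:
  assumes "g \<in> VC" "continuous_on \<Omega> f" "\<And>\<omega>. \<omega> \<in> \<Omega> \<Longrightarrow> \<bar>f \<omega>\<bar> \<le> \<bar>g \<omega>\<bar>"
  shows "f \<in> VC"
  using assms unfolding VC_def by (auto intro: order_trans)

lemma VC_continuous: "f \<in> VC \<Longrightarrow> continuous_on \<Omega> f"
  by (simp add: VC_def)

lemma
  assumes "f \<in> VC"
  shows VC_openin_less: "openin (top_of_set \<Omega>) {\<omega>\<in>\<Omega>. f \<omega> < c}"
    and VC_openin_greater: "openin (top_of_set \<Omega>) {\<omega>\<in>\<Omega>. c < f \<omega>}"
  using continuous_openin_preimage_gen[OF VC_continuous[OF assms], of "{..<c}"]
    continuous_openin_preimage_gen[OF VC_continuous[OF assms], of "{c<..}"]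
  by (simp_all add: vimage_def Int_def)

lemma VC_max: "f \<in> VC \<Longrightarrow> g \<in> VC \<Longrightarrow> (\<lambda>\<omega>. max (f \<omega>) (g \<omega>)) \<in> VC"
proof -
  assume fg: "f \<in> VC" "g \<in> VC"
  have abs: "(\<lambda>\<omega>. \<bar>h \<omega>\<bar>) \<in> VC" if "h \<in> VC" for h
    by (rule VC_abs_le[OF that]) (auto intro!: continuous_intros VC_continuous[OF that])
  show ?thesis
    by (rule VC_abs_le[OF fun_subspace_add[OF VC_subspace abs[OF fg(1)] abs[OF fg(2)]]])
      (use fg VC_continuous in \<open>auto intro!: continuous_intros\<close>)
qed

lemma VC_min: "f \<in> VC \<Longrightarrow> g \<in> VC \<Longrightarrow> (\<lambda>\<omega>. min (f \<omega>) (g \<omega>)) \<in> VC"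
proof -
  assume fg: "f \<in> VC" "g \<in> VC"
  have "(\<lambda>\<omega>. (f \<omega> + g \<omega>) - max (f \<omega>) (g \<omega>)) \<in> VC"
    by (intro VC_intros VC_max fg)
  moreover have "(\<lambda>\<omega>. (f \<omega> + g \<omega>) - max (f \<omega>) (g \<omega>)) = (\<lambda>\<omega>. min (f \<omega>) (g \<omega>))"
    by (auto simp: max_def min_def)
  ultimately show ?thesis by simp
qed

lemma sublevel_Union: "\<Omega> = (\<Union>n. {\<omega>\<in>\<Omega>. Z \<omega> \<le> real n})"
  using real_arch_simple by auto

text \<open>The compact sublevel sets of Z exhaust \<open>\<Omega>\<close>. This is what lets Borel
  subsets of \<open>\<Omega>\<close> be treated as Borel sets of the whole space when inner
  regularity is applied.\<close>

lemma Omega_borel: "\<Omega> \<in> sets borel"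
proof -
  have "{\<omega>\<in>\<Omega>. Z \<omega> \<le> real n} \<in> sets borel" for n
    using Z_compact by (intro borel_compact) simp
  then show ?thesis by (subst sublevel_Union) auto
qed

end

section \<open>Measures from Daniell functionals\<close>

text \<open>An abstract integral on \<open>VC\<close>: positive, normalised, and continuous along
  sequences decreasing to 0. Subgradients of the superhedging functional will be instances.\<close>

locale daniell_functional = weighted_space +
  fixes \<psi> :: "('a \<Rightarrow> real) \<Rightarrow> real"
  assumes lin: "fun_linear_on VC \<psi>"
    and mono: "f \<in> VC \<Longrightarrow> g \<in> VC \<Longrightarrow> (\<And>\<omega>. \<omega> \<in> \<Omega> \<Longrightarrow> f \<omega> \<le> g \<omega>) \<Longrightarrow> \<psi> f \<le> \<psi> g"
    and one: "\<psi> (\<lambda>_. 1) = 1"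
    and daniell: "\<And>f :: nat \<Rightarrow> 'a \<Rightarrow> real. (\<And>n. f n \<in> VC) \<Longrightarrow> (\<And>n \<omega>. \<omega> \<in> \<Omega> \<Longrightarrow> f (Suc n) \<omega> \<le> f n \<omega>) \<Longrightarrow>
      (\<And>\<omega>. \<omega> \<in> \<Omega> \<Longrightarrow> (\<lambda>n. f n \<omega>) \<longlonglongrightarrow> 0) \<Longrightarrow> (\<lambda>n. \<psi> (f n)) \<longlonglongrightarrow> 0"
begin

lemmas psi_add = fun_linear_add[OF lin] and psi_scale = fun_linear_scale[OF lin]

lemma psi_diff: "f \<in> VC \<Longrightarrow> g \<in> VC \<Longrightarrow> \<psi> (\<lambda>\<omega>. f \<omega> - g \<omega>) = \<psi> f - \<psi> g"
  using psi_add[of "\<lambda>\<omega>. f \<omega> - g \<omega>" g] fun_subspace_diff[OF VC_subspace] by simp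

lemma psi_const: "\<psi> (\<lambda>_. m) = m"
  using psi_scale[OF VC_const[of 1], of m] one by simp

lemma psi_nonneg: "f \<in> VC \<Longrightarrow> (\<And>\<omega>. \<omega> \<in> \<Omega> \<Longrightarrow> 0 \<le> f \<omega>) \<Longrightarrow> 0 \<le> \<psi> f"
  using mono[OF VC_const[of 0], of f] psi_const[of 0] by simp

lemma psi_sum:
  "finite I \<Longrightarrow> (\<And>i. i \<in> I \<Longrightarrow> f i \<in> VC) \<Longrightarrow>
    (\<lambda>\<omega>. \<Sum>i\<in>I. f i \<omega>) \<in> VC \<and> \<psi> (\<lambda>\<omega>. \<Sum>i\<in>I. f i \<omega>) = (\<Sum>i\<in>I. \<psi> (f i))"
  by (induction I rule: finite_induct) (auto simp: psi_add psi_const VC_const VC_intros)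

section \<open>Content of open sets and the outer measure it induces\<close>

definition tests :: "'a set \<Rightarrow> ('a \<Rightarrow> real) set" where
  "tests U = {f \<in> VC. \<forall>\<omega>\<in>\<Omega>. 0 \<le> f \<omega> \<and> f \<omega> \<le> indicator U \<omega>}"

text \<open>The content of the Riesz representation theorem, with continuous functions below the
  indicator instead of compactly supported ones. The countable subadditivity usually drawn from
  compact supports is drawn from \<open>daniell\<close>.\<close>

definition open_content :: "'a set \<Rightarrow> ennreal" where
  "open_content U = (SUP f\<in>tests U. ennreal (\<psi> f))"

definition outer :: "'a set \<Rightarrow> ennreal" where
  "outer E = (INF U\<in>{U. openin (top_of_set \<Omega>) U \<and> E \<subseteq> U}. open_content U)"

lemma tests_bounds:
  assumes "f \<in> tests U" "\<omega> \<in> \<Omega>"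
  shows "0 \<le> f \<omega>" "f \<omega> \<le> indicator U \<omega>" "f \<omega> \<le> 1" "\<omega> \<notin> U \<Longrightarrow> f \<omega> = 0"
proof -
  show *: "0 \<le> f \<omega>" "f \<omega> \<le> indicator U \<omega>" using assms by (auto simp: tests_def)
  show "f \<omega> \<le> 1" by (rule order_trans[OF *(2)]) (simp add: indicator_def)
  show "f \<omega> = 0" if "\<omega> \<notin> U" using * that by simp
qed

lemma tests_mono: "U \<subseteq> W \<Longrightarrow> tests U \<subseteq> tests W"
proof
  fix f assume UW: "U \<subseteq> W" and f: "f \<in> tests U"
  have "f \<omega> \<le> indicator W \<omega>" if "\<omega> \<in> \<Omega>" for \<omega>
    using tests_bounds[OF f that] UW by (auto simp: indicator_def)
  then show "f \<in> tests W" using f by (auto simp: tests_def)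
qed

lemma open_content_upper: "f \<in> tests U \<Longrightarrow> ennreal (\<psi> f) \<le> open_content U"
  unfolding open_content_def by (rule SUP_upper)

lemma open_content_mono: "U \<subseteq> W \<Longrightarrow> open_content U \<le> open_content W"
  unfolding open_content_def using tests_mono by (intro SUP_subset_mono) auto

lemma tests_psi: "f \<in> tests U \<Longrightarrow> 0 \<le> \<psi> f" "f \<in> tests U \<Longrightarrow> \<psi> f \<le> 1"
proof -
  assume f: "f \<in> tests U"
  then show "0 \<le> \<psi> f" by (intro psi_nonneg) (auto simp: tests_def)
  show "\<psi> f \<le> 1" using mono[OF _ VC_const[of 1], of f] f one tests_bounds[OF f] by (simp add: tests_def)
qed

lemma open_content_le_1: "open_content U \<le> 1"
  unfolding open_content_def by (rule SUP_least) (use tests_psi in auto)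

lemma open_content_Omega: "open_content \<Omega> = 1"
proof (rule antisym[OF open_content_le_1])
  have "(\<lambda>_. 1) \<in> tests \<Omega>" by (simp add: tests_def VC_const)
  from open_content_upper[OF this] show "1 \<le> open_content \<Omega>" by (simp add: one)
qed

lemma zero_in_tests: "(\<lambda>_. 0) \<in> tests U"
  by (simp add: tests_def VC_const)

lemma open_content_empty: "open_content {} = 0"
proof -
  have "\<psi> f \<le> 0" if "f \<in> tests {}" for f
    using mono[OF _ VC_const[of 0], of f] that psi_const[of 0] by (auto simp: tests_def)
  then have "open_content {} \<le> 0" unfolding open_content_def by (intro SUP_least) (simp add: ennreal_neg)
  then show ?thesis by simp
qed

text \<open>Truncated multiples of the distance to the complement of U do this: the distance is
  positive on U, so the value 1 is reached at a finite n and not only in the limit. An empty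
  complement is treated separately because \<open>infdist\<close> to the empty set is 0.\<close>

lemma open_approx:
  assumes U: "openin (top_of_set \<Omega>) U"
  obtains g where "\<And>n. g n \<in> tests U" "\<And>n \<omega>. \<omega> \<in> \<Omega> \<Longrightarrow> g n \<omega> \<le> g (Suc n) \<omega>"
    "\<And>\<omega>. \<omega> \<in> U \<Longrightarrow> \<exists>n. g n \<omega> = 1"
proof (cases "\<Omega> - U = {}")
  case True
  show ?thesis
  proof (rule that[of "\<lambda>_ _. 1"])
    show "(\<lambda>_. 1) \<in> tests U" using True by (auto simp: tests_def VC_const indicator_def)
  qed auto
next
  case False
  define g where "g n \<omega> = min 1 (real n * infdist \<omega> (\<Omega> - U))" for n \<omega>
  have 0: "0 \<le> g n \<omega>" "g n \<omega> \<le> 1" for n \<omega> by (auto simp: g_def infdist_nonneg)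
  show ?thesis
  proof (rule that[of g])
    fix n
    have "continuous_on \<Omega> (g n)" unfolding g_def by (intro continuous_intros)
    then have "g n \<in> VC" by (rule VC_abs_le[OF VC_const[of 1]]) (use 0 in auto)
    moreover have "g n \<omega> = 0" if "\<omega> \<in> \<Omega>" "\<omega> \<notin> U" for \<omega> using that by (simp add: g_def)
    ultimately show "g n \<in> tests U" using 0 by (auto simp: tests_def indicator_def)
  next
    fix n \<omega> show "g n \<omega> \<le> g (Suc n) \<omega>"
      unfolding g_def by (intro min.mono mult_right_mono) (auto simp: infdist_nonneg)
  next
    fix \<omega> assume w: "\<omega> \<in> U"
    obtain T where T: "open T" "U = \<Omega> \<inter> T" using U by (auto simp: openin_open)
    have "\<omega> \<notin> closure (\<Omega> - U)"
      using w T closure_iff_nhds_not_empty[of \<omega> "\<Omega> - U"] by blast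
    then have "infdist \<omega> (\<Omega> - U) > 0"
      using False in_closure_iff_infdist_zero[of "\<Omega> - U" \<omega>] infdist_nonneg[of \<omega> "\<Omega> - U"] by force
    then obtain n where "1 < real n * infdist \<omega> (\<Omega> - U)" using reals_Archimedean3 by blast
    then show "\<exists>n. g n \<omega> = 1" unfolding g_def by (intro exI[of _ n]) simp
  qed
qed

text \<open>A test function f of the union is eventually dominated, at each point, by the partial
  sums \<open>s n\<close> of functions exhausting the single sets. Hence f - min f
  (\<open>s n\<close>) decreases to 0, and \<open>daniell\<close> bounds \<psi> f by the limit of
  \<psi> (\<open>s n\<close>).\<close>

lemma open_content_Union:
  assumes U: "\<And>i::nat. openin (top_of_set \<Omega>) (U i)"
  shows "open_content (\<Union>i. U i) \<le> (\<Sum>i. open_content (U i))"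
  unfolding open_content_def[of "\<Union>i. U i"]
proof (rule SUP_least)
  fix f assume f: "f \<in> tests (\<Union>i. U i)"
  have "\<exists>g. (\<forall>n. g n \<in> tests (U i)) \<and> (\<forall>n. \<forall>\<omega>\<in>\<Omega>. g n \<omega> \<le> g (Suc n) \<omega>) \<and> (\<forall>\<omega>\<in>U i. \<exists>n. g n \<omega> = 1)" for i
    by (rule open_approx[OF U[of i]]) blast
  then obtain g where g: "\<And>i n. g i n \<in> tests (U i)"
    and inc: "\<And>i n \<omega>. \<omega> \<in> \<Omega> \<Longrightarrow> g i n \<omega> \<le> g i (Suc n) \<omega>"
    and one: "\<And>i \<omega>. \<omega> \<in> U i \<Longrightarrow> \<exists>n. g i n \<omega> = 1" by metis
  have gV: "g i n \<in> VC" and g0: "\<omega> \<in> \<Omega> \<Longrightarrow> 0 \<le> g i n \<omega>" for i n \<omega> using g by (auto simp: tests_def)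
  have fV: "f \<in> VC" using f by (simp add: tests_def)
  \<comment> \<open>A diagonal choice: the number of sets and the index of approximation grow
    together, so one index n suffices for \<open>daniell\<close>.\<close>
  define s where "s n \<omega> = (\<Sum>i<n. g i n \<omega>)" for n \<omega>
  have sV: "s n \<in> VC" and psis: "\<psi> (s n) = (\<Sum>i<n. \<psi> (g i n))" for n
    using psi_sum[of "{..<n}" "\<lambda>i. g i n"] gV unfolding s_def by auto
  have sinc: "s n \<omega> \<le> s (Suc n) \<omega>" if "\<omega> \<in> \<Omega>" for n \<omega>
    using sum_mono[of "{..<n}" "\<lambda>i. g i n \<omega>" "\<lambda>i. g i (Suc n) \<omega>"] inc[OF that] g0[OF that, of n "Suc n"]
    unfolding s_def by simp
  define h where "h n \<omega> = f \<omega> - min (f \<omega>) (s n \<omega>)" for n \<omega>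
  have hV: "h n \<in> VC" for n unfolding h_def by (intro VC_intros VC_min fV sV)
  have "(\<lambda>n. \<psi> (h n)) \<longlonglongrightarrow> 0"
  proof (rule daniell)
    show "h n \<in> VC" for n by (rule hV)
    show "h (Suc n) \<omega> \<le> h n \<omega>" if "\<omega> \<in> \<Omega>" for n \<omega>
      using sinc[OF that, of n] by (auto simp: h_def)
    fix \<omega> assume w: "\<omega> \<in> \<Omega>"
    show "(\<lambda>n. h n \<omega>) \<longlonglongrightarrow> 0"
    proof (cases "\<omega> \<in> (\<Union>i. U i)")
      case False
      then have "f \<omega> = 0" by (rule tests_bounds[OF f w])
      moreover have "0 \<le> s n \<omega>" for n unfolding s_def by (intro sum_nonneg g0 w)
      ultimately show ?thesis by (simp add: h_def)
    next
      case True
      then obtain i m where m: "g i m \<omega> = 1" using one by blast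
      have f1: "f \<omega> \<le> 1" by (rule tests_bounds[OF f w])
      have "h n \<omega> = 0" if n: "n \<ge> max (Suc i) m" for n
      proof -
        have "g i m \<omega> \<le> g i n \<omega>" 
          by (rule lift_Suc_mono_le[of "\<lambda>n. g i n \<omega>", OF inc[OF w]]) (use n in simp)
        also have "\<dots> \<le> s n \<omega>" unfolding s_def using n w
          by (intro member_le_sum) (auto simp: g0)
        finally show ?thesis using m f1 by (simp add: h_def)
      qed
      then show ?thesis by (intro tendsto_eventually eventually_sequentiallyI) blast
    qed
  qed
  then have lim: "(\<lambda>n. ennreal (\<psi> (h n)) + (\<Sum>i. open_content (U i))) \<longlonglongrightarrow> ennreal 0 + (\<Sum>i. open_content (U i))"
    by (intro tendsto_intros tendsto_ennrealI)
  have "ennreal (\<psi> f) \<le> ennreal (\<psi> (h n)) + (\<Sum>i. open_content (U i))" for n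
  proof -
    have h0: "0 \<le> \<psi> (h n)" by (intro psi_nonneg hV) (simp add: h_def)
    have "\<psi> f = \<psi> (h n) + \<psi> (\<lambda>\<omega>. min (f \<omega>) (s n \<omega>))"
      unfolding h_def using psi_diff[OF fV VC_min[OF fV sV]] by simp
    moreover have "\<psi> (\<lambda>\<omega>. min (f \<omega>) (s n \<omega>)) \<le> \<psi> (s n)" by (intro mono VC_min fV sV) simp
    ultimately have "ennreal (\<psi> f) \<le> ennreal (\<psi> (h n) + (\<Sum>i<n. \<psi> (g i n)))"
      using psis by (intro ennreal_leI) simp
    also have "\<dots> = ennreal (\<psi> (h n)) + (\<Sum>i<n. ennreal (\<psi> (g i n)))"
      using h0 tests_psi(1)[OF g] by (simp add: ennreal_plus sum_nonneg sum_ennreal)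
    also have "(\<Sum>i<n. ennreal (\<psi> (g i n))) \<le> (\<Sum>i<n. open_content (U i))"
      by (intro sum_mono open_content_upper g)
    also have "(\<Sum>i<n. open_content (U i)) \<le> (\<Sum>i. open_content (U i))" by (rule sum_le_suminf) auto
    finally show ?thesis by (simp add: add_left_mono)
  qed
  then show "ennreal (\<psi> f) \<le> (\<Sum>i. open_content (U i))"
    using LIMSEQ_le_const[OF lim] by simp
qed

lemma outer_open: "openin (top_of_set \<Omega>) U \<Longrightarrow> outer U = open_content U"
  unfolding outer_def by (intro antisym INF_lower INF_greatest open_content_mono) auto

lemma outer_le: "openin (top_of_set \<Omega>) U \<Longrightarrow> E \<subseteq> U \<Longrightarrow> outer E \<le> open_content U"
  unfolding outer_def by (intro INF_lower) auto

lemma outer_mono: "E \<subseteq> F \<Longrightarrow> outer E \<le> outer F"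
  unfolding outer_def by (intro INF_superset_mono) auto

lemma outer_Union:
  assumes A: "\<And>n::nat. A n \<subseteq> \<Omega>"
  shows "outer (\<Union>n. A n) \<le> (\<Sum>n. outer (A n))"
proof (rule ennreal_le_epsilon)
  fix e :: real assume e: "0 < e" "(\<Sum>n. outer (A n)) < top"
  have "\<exists>U. openin (top_of_set \<Omega>) U \<and> A n \<subseteq> U \<and> open_content U \<le> outer (A n) + ennreal (e * (1/2) ^ Suc n)" for n
  proof -
    \<comment> \<open>Finiteness matters: only below \<open>top\<close> does adding a positive
      amount give the strict inequality from which the open superset is chosen.\<close>
    have "outer (A n) < top"
      using outer_le[of \<Omega> "A n"] A[of n] open_content_Omega by (auto simp: less_top[symmetric] top_unique)
    then have "outer (A n) < outer (A n) + ennreal (e * (1/2) ^ Suc n)" using e(1) by simp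
    then show ?thesis
      unfolding outer_def[of "A n"] INF_less_iff by (auto intro: less_imp_le)
  qed
  then obtain U where U: "\<And>n. openin (top_of_set \<Omega>) (U n)" "\<And>n. A n \<subseteq> U n"
    "\<And>n. open_content (U n) \<le> outer (A n) + ennreal (e * (1/2) ^ Suc n)" by metis
  have "outer (\<Union>n. A n) \<le> open_content (\<Union>n. U n)"
    using U(1,2) by (intro outer_le) auto
  also have "\<dots> \<le> (\<Sum>n. open_content (U n))" by (rule open_content_Union[OF U(1)])
  also have "\<dots> \<le> (\<Sum>n. outer (A n) + ennreal (e * (1/2) ^ Suc n))"
    by (intro suminf_le U(3)) auto
  also have "\<dots> = (\<Sum>n. outer (A n)) + (\<Sum>n. ennreal (e * (1/2) ^ Suc n))"
    by (intro suminf_add[symmetric]) auto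
  also have "(\<Sum>n. ennreal (e * (1/2) ^ Suc n)) = ennreal e"
    using sums_mult[OF power_half_series, of e] e(1) by (intro suminf_ennreal_eq) auto
  finally show "outer (\<Union>n. A n) \<le> (\<Sum>n. outer (A n)) + ennreal e" .
qed

lemma outer_empty: "outer {} = 0"
  using outer_open[of "{}"] open_content_empty by simp

lemma outer_measure_outer: "outer_measure_space (Pow \<Omega>) outer"
  unfolding outer_measure_space_def positive_def increasing_def countably_subadditive_def
proof (intro conjI allI ballI impI)
  fix A :: "nat \<Rightarrow> 'a set" assume "range A \<subseteq> Pow \<Omega>"
  then have "\<And>n. A n \<subseteq> \<Omega>" by blast
  then show "outer (\<Union>i. A i) \<le> (\<Sum>i. outer (A i))" by (rule outer_Union)
qed (auto simp: outer_empty intro: outer_mono)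

lemma outer_Un: "A \<subseteq> \<Omega> \<Longrightarrow> B \<subseteq> \<Omega> \<Longrightarrow> outer (A \<union> B) \<le> outer A + outer B"
proof -
  assume AB: "A \<subseteq> \<Omega>" "B \<subseteq> \<Omega>"
  have "outer (\<Union>n. binaryset A B n) \<le> (\<Sum>n. outer (binaryset A B n))"
    using AB by (intro outer_Union) (auto simp: binaryset_def)
  then show ?thesis
    using suminf_binaryset_eq[of outer A B] outer_empty by (simp add: UN_binaryset_eq)
qed

text \<open>A test function of \<^term>\<open>W \<inter> U\<close> that is nearly optimal, cut off at a small level d, has
  support away from the open set where it is below d, and that set contains \<^term>\<open>W - U\<close>.\<close>

lemma open_content_split:
  assumes U: "openin (top_of_set \<Omega>) U" and W: "openin (top_of_set \<Omega>) W"
  shows "open_content (W \<inter> U) + outer (W - U) \<le> open_content W"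
proof (rule ennreal_le_epsilon)
  fix e :: real assume e: "0 < e" "open_content W < top"
  have fin: "open_content (W \<inter> U) \<noteq> top"
    using open_content_le_1[of "W \<inter> U"] by (auto simp: top_unique)
  have "\<exists>f\<in>tests (W \<inter> U). open_content (W \<inter> U) \<le> ennreal (\<psi> f) + ennreal (e / 2)"
  \<comment> \<open>Subtraction in \<open>ennreal\<close> is truncated at 0 and strictly lowers only
    positive values, so a zero content is handled by the zero function.\<close>
  proof (cases "open_content (W \<inter> U) = 0")
    case True
    then show ?thesis using zero_in_tests by auto
  next
    case False
    then have "open_content (W \<inter> U) - ennreal (e / 2) < open_content (W \<inter> U)"
      using e(1) fin by (intro ennreal_between) (auto simp: zero_less_iff_neq_zero less_top[symmetric])
    then obtain f where "f \<in> tests (W \<inter> U)" "open_content (W \<inter> U) - ennreal (e / 2) < ennreal (\<psi> f)"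
      unfolding open_content_def less_SUP_iff by blast
    then show ?thesis by (auto simp: ennreal_minus_le_iff add.commute dest!: less_imp_le intro!: bexI[of _ f])
  qed
  then obtain f where f: "f \<in> tests (W \<inter> U)" and close: "open_content (W \<inter> U) \<le> ennreal (\<psi> f) + ennreal (e / 2)"
    by blast
  have fV: "f \<in> VC" using f by (simp add: tests_def)
  \<comment> \<open>One half of e is lost in choosing f, the other half in cutting f off at
    d.\<close>
  define d where "d = e / 2"
  have d: "d > 0" using e by (simp add: d_def)
  define N where "N = {\<omega>\<in>W. f \<omega> < d}"
  have WO: "W \<subseteq> \<Omega>" using W by (auto dest: openin_imp_subset)
  have "openin (top_of_set \<Omega>) (W \<inter> {\<omega>\<in>\<Omega>. f \<omega> < d})" by (intro openin_Int W VC_openin_less fV)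
  moreover have "W \<inter> {\<omega>\<in>\<Omega>. f \<omega> < d} = N" using WO by (auto simp: N_def)
  ultimately have N: "openin (top_of_set \<Omega>) N" by simp
  have sub: "W - U \<subseteq> N"
    using tests_bounds(4)[OF f] WO d by (auto simp: N_def)
  define f' where "f' \<omega> = max (f \<omega> - d) 0" for \<omega>
  have f'V: "f' \<in> VC" unfolding f'_def by (intro VC_max VC_intros VC_const fV)
  have f'0: "0 \<le> \<psi> f'" by (rule psi_nonneg[OF f'V]) (simp add: f'_def)
  have "\<psi> (\<lambda>\<omega>. f \<omega> - d) \<le> \<psi> f'" by (intro mono f'V VC_intros VC_const fV) (simp add: f'_def)
  then have ff': "\<psi> f \<le> \<psi> f' + d" using psi_diff[OF fV VC_const[of d]] psi_const by simp
  have "open_content N + ennreal (\<psi> f') \<le> open_content W"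
  proof -
    have "ennreal (\<psi> g) + ennreal (\<psi> f') \<le> open_content W" if g: "g \<in> tests N" for g
    proof -
      have gV: "g \<in> VC" using g by (simp add: tests_def)
      have "(\<lambda>\<omega>. g \<omega> + f' \<omega>) \<in> tests W"
        unfolding tests_def
      proof (intro CollectI conjI ballI)
        show "(\<lambda>\<omega>. g \<omega> + f' \<omega>) \<in> VC" by (intro VC_intros gV f'V)
        fix \<omega> assume w: "\<omega> \<in> \<Omega>"
        show "0 \<le> g \<omega> + f' \<omega>" using g w by (auto simp: tests_def f'_def)
        have gi: "0 \<le> g \<omega>" "g \<omega> \<le> indicator N \<omega>" and fi: "0 \<le> f \<omega>" "f \<omega> \<le> indicator (W \<inter> U) \<omega>"
          using f g w by (auto simp: tests_def)
        show "g \<omega> + f' \<omega> \<le> indicator W \<omega>"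
        \<comment> \<open>The two summands never overlap: on N the function f is below d, so
          \<open>f'\<close> vanishes, and off N the function g vanishes.\<close>
        proof (cases "\<omega> \<in> N")
          case True
          then show ?thesis using gi by (auto simp: N_def f'_def)
        next
          case False
          then have "g \<omega> = 0" using gi by simp
          then show ?thesis using fi d tests_bounds(3)[OF f w]
            by (auto simp: f'_def indicator_def split: if_splits)
        qed
      qed
      from open_content_upper[OF this] show ?thesis
        using psi_add[OF gV f'V] tests_psi(1)[OF g] f'0 by (simp add: ennreal_plus)
    qed
    then have "(SUP g\<in>tests N. ennreal (\<psi> g) + ennreal (\<psi> f')) \<le> open_content W" by (rule SUP_least)
    moreover have "(SUP g\<in>tests N. ennreal (\<psi> g) + ennreal (\<psi> f')) = open_content N + ennreal (\<psi> f')"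
      unfolding open_content_def using zero_in_tests[of N] by (intro ennreal_SUP_add_left) auto
    ultimately show ?thesis by simp
  qed
  moreover have "open_content (W \<inter> U) \<le> ennreal (\<psi> f') + ennreal e"
  proof -
    have "ennreal (\<psi> f) \<le> ennreal (\<psi> f') + ennreal (e / 2)"
      using ff' f'0 e(1) by (simp add: ennreal_plus[symmetric] d_def del: ennreal_plus)
    then have "open_content (W \<inter> U) \<le> ennreal (\<psi> f') + ennreal (e / 2) + ennreal (e / 2)"
      using close by (meson add_right_mono order_trans)
    then show ?thesis using e(1) by (simp add: add.assoc ennreal_plus[symmetric] del: ennreal_plus)
  qed
  moreover have "outer (W - U) \<le> open_content N" by (rule outer_le[OF N sub])
  ultimately have "open_content (W \<inter> U) + outer (W - U) \<le> (ennreal (\<psi> f') + ennreal e) + open_content N"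
    by (intro add_mono)
  also have "\<dots> = (open_content N + ennreal (\<psi> f')) + ennreal e" by (simp add: ac_simps)
  also have "\<dots> \<le> open_content W + ennreal e" by (intro add_right_mono) fact
  finally show "open_content (W \<inter> U) + outer (W - U) \<le> open_content W + ennreal e" .
qed

text \<open>Caratheodory's criterion for an arbitrary E follows from its version for open sets:
  split each open W containing E, then take the infimum over W.\<close>

lemma open_in_lambda_system:
  assumes U: "openin (top_of_set \<Omega>) U"
  shows "U \<in> lambda_system \<Omega> (Pow \<Omega>) outer"
proof -
  interpret algebra \<Omega> "Pow \<Omega>" by (rule algebra_Pow)
  have "outer (E \<inter> U) + outer (E - U) = outer E" if E: "E \<subseteq> \<Omega>" for E
  proof (rule antisym)
    have "outer (E \<inter> U) + outer (E - U) \<le> open_content W"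
      if W: "openin (top_of_set \<Omega>) W" "E \<subseteq> W" for W
    proof -
      have "outer (E \<inter> U) + outer (E - U) \<le> open_content (W \<inter> U) + outer (W - U)"
        using W U by (intro add_mono outer_le openin_Int outer_mono) auto
      also have "\<dots> \<le> open_content W" by (rule open_content_split[OF U W(1)])
      finally show ?thesis .
    qed
    then show "outer (E \<inter> U) + outer (E - U) \<le> outer E"
      unfolding outer_def[of E] by (intro INF_greatest) auto
    show "outer E \<le> outer (E \<inter> U) + outer (E - U)"
      using outer_Un[of "E \<inter> U" "E - U"] E by (auto simp: Int_Diff_Un)
  qed
  then show ?thesis
    using U by (auto simp: lambda_system_eq dest: openin_imp_subset)
qed

section \<open>The representing measure and integration against it\<close>

definition P :: "'a measure" where
  "P = distr (measure_of \<Omega> (lambda_system \<Omega> (Pow \<Omega>) outer) outer) (restrict_space borel \<Omega>) (\<lambda>\<omega>. \<omega>)"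

lemma sets_P: "sets P = sets (restrict_space borel \<Omega>)" and space_P: "space P = \<Omega>"
  by (simp_all add: P_def space_restrict_space)

lemma openin_sets_P: "openin (top_of_set \<Omega>) U \<Longrightarrow> U \<in> sets P"
  unfolding sets_P sets_restrict_space openin_open by auto

text \<open>Relatively open sets are Caratheodory measurable, so the identity into the Borel sets of
  \<open>\<Omega>\<close> is measurable. Taking the image measure therefore keeps the values of
  \<open>outer\<close> and merely discards the larger sigma-algebra.\<close>

lemma emeasure_P_open:
  assumes U: "openin (top_of_set \<Omega>) U"
  shows "emeasure P U = open_content U"
proof -
  let ?L = "lambda_system \<Omega> (Pow \<Omega>) outer"
  let ?M = "measure_of \<Omega> ?L outer"
  have ms: "measure_space \<Omega> ?L outer"
    using sigma_algebra.caratheodory_lemma[OF sigma_algebra_Pow outer_measure_outer] .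
  then have sa: "sigma_algebra \<Omega> ?L" by (simp add: measure_space_def)
  then interpret sigma_algebra \<Omega> ?L .
  have sM: "sets ?M = ?L" and spM: "space ?M = \<Omega>"
    using sets_measure_of_eq space_measure_of_eq by auto
  have "(\<lambda>\<omega>. \<omega>) \<in> ?M \<rightarrow>\<^sub>M borel"
    by (rule borel_measurableI)
      (use open_in_lambda_system openin_open_Int[of _ \<Omega>] in \<open>auto simp: sM spM Int_commute\<close>)
  then have meas: "(\<lambda>\<omega>. \<omega>) \<in> ?M \<rightarrow>\<^sub>M restrict_space borel \<Omega>"
    by (intro measurable_restrict_space2) (auto simp: spM)
  obtain T where T: "open T" "U = \<Omega> \<inter> T" using U by (auto simp: openin_open)
  have "U \<in> sets (restrict_space borel \<Omega>)" using openin_sets_P[OF U] sets_P by simp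
  then have "emeasure P U = emeasure ?M U"
    unfolding P_def using T by (subst emeasure_distr[OF meas]) (auto simp: spM intro!: arg_cong[of _ _ "emeasure ?M"])
  also have "\<dots> = outer U"
    using ms open_in_lambda_system[OF U]
    by (intro emeasure_measure_of_sigma) (auto simp: measure_space_def sa)
  finally show ?thesis using outer_open[OF U] by simp
qed

lemma prob_P: "prob_space P"
  by (rule prob_spaceI) (simp add: space_P emeasure_P_open open_content_Omega)

sublocale P: prob_space P by (rule prob_P)

lemma VC_measurable_P: "f \<in> VC \<Longrightarrow> f \<in> borel_measurable P"
  using borel_measurable_continuous_on_restrict[OF VC_continuous] measurable_cong_sets[OF sets_P refl]
  by blast

lemma sum_unit_slices: "0 \<le> y \<Longrightarrow> (\<Sum>k<n. max 0 (min 1 (y - real k))) = min y (real n)"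
  by (induction n) (auto simp: min_def max_def)

text \<open>Both \<open>\<psi>\<close> and the integral of the slice between levels k/n and (k+1)/n lie between the
  contents of two consecutive superlevel sets, so telescoping bounds the difference by 1/n.\<close>

lemma integral_P_unit:
  assumes f: "f \<in> VC" and f01: "\<And>\<omega>. \<omega> \<in> \<Omega> \<Longrightarrow> 0 \<le> f \<omega> \<and> f \<omega> \<le> 1"
  shows "integral\<^sup>L P f = \<psi> f"
proof -
  have close: "real n * \<bar>integral\<^sup>L P f - \<psi> f\<bar> \<le> 1" for n
  proof -
    define g where "g k \<omega> = max 0 (min 1 (real n * f \<omega> - real k))" for k \<omega>
    define U where "U k = {\<omega>\<in>\<Omega>. real k < real n * f \<omega>}" for k
    have gV: "g k \<in> VC" for k
      unfolding g_def by (intro VC_max VC_min VC_const VC_intros f)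
    have U: "openin (top_of_set \<Omega>) (U k)" for k
      unfolding U_def by (intro VC_openin_greater VC_intros f)
    have Um: "U k \<in> sets P" for k
      by (rule openin_sets_P[OF U])
    have gt: "g k \<in> tests (U k)" for k
      using gV by (auto simp: tests_def g_def U_def indicator_def)
    have g01: "0 \<le> g k \<omega>" "g k \<omega> \<le> 1" for k \<omega> by (auto simp: g_def)
    \<comment> \<open>Where n f exceeds k + 1 the k-th slice is already saturated at 1.\<close>
    have ind_le: "indicator (U (Suc k)) \<omega> \<le> g k \<omega>" for k \<omega>
      by (auto simp: g_def U_def indicator_def)
    have gU: "g k \<omega> \<le> indicator (U k) \<omega>" if "\<omega> \<in> \<Omega>" for k \<omega>
      by (rule tests_bounds[OF gt that])
    have meas: "ennreal (measure P (U k)) = open_content (U k)" for k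
      using emeasure_P_open[OF U] by (simp add: P.emeasure_eq_measure)
    have up: "\<psi> (g k) \<le> measure P (U k)" for k
    proof -
      have "ennreal (\<psi> (g k)) \<le> ennreal (measure P (U k))" unfolding meas by (rule open_content_upper[OF gt])
      then show ?thesis by simp
    qed
    have low: "measure P (U (Suc k)) \<le> \<psi> (g k)" for k
    proof -
      have "ennreal (\<psi> h) \<le> ennreal (\<psi> (g k))" if h: "h \<in> tests (U (Suc k))" for h
      proof (intro ennreal_leI mono gV)
        show "h \<in> VC" using h by (simp add: tests_def)
        show "h \<omega> \<le> g k \<omega>" if "\<omega> \<in> \<Omega>" for \<omega>
          using tests_bounds(2)[OF h that] ind_le[of k \<omega>] by linarith
      qed
      then have "open_content (U (Suc k)) \<le> ennreal (\<psi> (g k))" unfolding open_content_def by (rule SUP_least)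
      then have "ennreal (measure P (U (Suc k))) \<le> ennreal (\<psi> (g k))" unfolding meas .
      then show ?thesis using tests_psi(1)[OF gt] by simp
    qed
    have int: "integrable P (g k)" for k
      by (rule P.integrable_const_bound[of _ 1]) (use g01 VC_measurable_P[OF gV] in auto)
    have indint: "integrable P (indicator (U k) :: 'a \<Rightarrow> real)" for k
      using Um by (simp add: P.emeasure_eq_measure)
    have UO: "U k \<inter> \<Omega> = U k" for k by (auto simp: U_def)
    have iup: "integral\<^sup>L P (g k) \<le> measure P (U k)" for k
      using integral_mono[OF int indint, of k k] gU Um by (simp add: space_P UO)
    have ilow: "measure P (U (Suc k)) \<le> integral\<^sup>L P (g k)" for k
      using integral_mono[OF indint int, of "Suc k" k] ind_le Um by (simp add: space_P UO)
    have sumg: "(\<Sum>k<n. g k \<omega>) = real n * f \<omega>" if "\<omega> \<in> \<Omega>" for \<omega>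
      unfolding g_def using f01[OF that] sum_unit_slices[of "real n * f \<omega>" n]
      by (simp add: min_def mult_left_le)
    have "real n * \<psi> f = \<psi> (\<lambda>\<omega>. \<Sum>k<n. g k \<omega>)"
    proof -
      have "\<psi> (\<lambda>\<omega>. real n * f \<omega>) = \<psi> (\<lambda>\<omega>. \<Sum>k<n. g k \<omega>)"
        using psi_sum[of "{..<n}" g] gV sumg by (intro antisym mono VC_intros f) auto
      then show ?thesis using psi_scale[OF f] by simp
    qed
    then have e1: "real n * \<psi> f = (\<Sum>k<n. \<psi> (g k))" using psi_sum[of "{..<n}" g] gV by simp
    have "real n * integral\<^sup>L P f = integral\<^sup>L P (\<lambda>\<omega>. real n * f \<omega>)" by simp
    also have "\<dots> = integral\<^sup>L P (\<lambda>\<omega>. \<Sum>k<n. g k \<omega>)"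
      by (intro Bochner_Integration.integral_cong) (auto simp: space_P sumg)
    also have "\<dots> = (\<Sum>k<n. integral\<^sup>L P (g k))" using int by (intro Bochner_Integration.integral_sum)
    finally have e2: "real n * integral\<^sup>L P f = (\<Sum>k<n. integral\<^sup>L P (g k))" .
    have "\<bar>real n * integral\<^sup>L P f - real n * \<psi> f\<bar> = \<bar>\<Sum>k<n. integral\<^sup>L P (g k) - \<psi> (g k)\<bar>"
      unfolding e1 e2 by (simp add: sum_subtractf)
    also have "\<dots> \<le> (\<Sum>k<n. \<bar>integral\<^sup>L P (g k) - \<psi> (g k)\<bar>)" by (rule sum_abs)
    also have "\<dots> \<le> (\<Sum>k<n. measure P (U k) - measure P (U (Suc k)))"
    proof (rule sum_mono)
      fix k show "\<bar>integral\<^sup>L P (g k) - \<psi> (g k)\<bar> \<le> measure P (U k) - measure P (U (Suc k))"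
        using up[of k] low[of k] iup[of k] ilow[of k] by linarith
    qed
    also have "\<dots> = measure P (U 0) - measure P (U n)" by (rule sum_lessThan_telescope')
    also have "\<dots> \<le> 1" using P.prob_le_1[of "U 0"] measure_nonneg[of P "U n"] by linarith
    finally show ?thesis by (simp add: abs_mult flip: right_diff_distrib)
  qed
  show ?thesis
  proof (rule ccontr)
    assume "integral\<^sup>L P f \<noteq> \<psi> f"
    then obtain n where "1 < real n * \<bar>integral\<^sup>L P f - \<psi> f\<bar>"
      using reals_Archimedean3[of "\<bar>integral\<^sup>L P f - \<psi> f\<bar>"] by auto
    with close[of n] show False by simp
  qed
qed

text \<open>Truncating f at n and dividing by n reduces to values in [0,1]. The truncation is
  removed by monotone convergence on the side of the integral and by \<open>daniell\<close>, applied
  to the remainders f - min f n, on the side of \<psi>.\<close>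

lemma integral_P_nonneg:
  assumes f: "f \<in> VC" and f0: "\<And>\<omega>. \<omega> \<in> \<Omega> \<Longrightarrow> 0 \<le> f \<omega>"
  shows "(\<integral>\<^sup>+\<omega>. ennreal (f \<omega>) \<partial>P) = ennreal (\<psi> f)"
proof -
  have mV: "(\<lambda>\<omega>. min (f \<omega>) (real n)) \<in> VC" for n by (intro VC_min VC_const f)
  have eq: "(\<integral>\<^sup>+\<omega>. ennreal (min (f \<omega>) (real n)) \<partial>P) = ennreal (\<psi> (\<lambda>\<omega>. min (f \<omega>) (real n)))" for n
  proof -
    have int: "integrable P (\<lambda>\<omega>. min (f \<omega>) (real n))"
      by (rule P.integrable_const_bound[of _ "real n"]) (use f0 VC_measurable_P[OF mV] in \<open>auto simp: space_P intro!: AE_I2\<close>)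
    have "integral\<^sup>L P (\<lambda>\<omega>. min (f \<omega>) (real n)) = \<psi> (\<lambda>\<omega>. min (f \<omega>) (real n))"
    \<comment> \<open>Division by n is impossible here, but the truncation at 0 vanishes on
      \<open>\<Omega>\<close>.\<close>
    proof (cases "n = 0")
      case True
      have "integral\<^sup>L P (\<lambda>\<omega>. min (f \<omega>) (real n)) = integral\<^sup>L P (\<lambda>_. 0)"
        by (intro Bochner_Integration.integral_cong) (auto simp: True space_P f0)
      moreover have "\<psi> (\<lambda>\<omega>. min (f \<omega>) (real n)) = \<psi> (\<lambda>_. 0)"
        by (intro antisym mono mV VC_const) (auto simp: True f0)
      ultimately show ?thesis using psi_const[of 0] by simp
    next
      case False
      let ?g = "\<lambda>\<omega>. (1 / real n) * min (f \<omega>) (real n)"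
      have "integral\<^sup>L P ?g = \<psi> ?g"
      proof (rule integral_P_unit)
        show "?g \<in> VC" by (rule fun_subspace_scale[OF VC_subspace mV])
        show "0 \<le> ?g \<omega> \<and> ?g \<omega> \<le> 1" if "\<omega> \<in> \<Omega>" for \<omega>
          using f0[OF that] False by (simp add: divide_simps)
      qed
      then show ?thesis using psi_scale[OF mV, of "1 / real n" n] False by simp
    qed
    then show ?thesis using nn_integral_eq_integral[OF int] f0
      by (subst nn_integral_eq_integral[OF int]) (auto simp: space_P intro!: AE_I2)
  qed
  have conv: "\<exists>N. \<forall>n\<ge>N. min (f \<omega>) (real n) = f \<omega>" for \<omega>
  proof -
    obtain N where "f \<omega> \<le> real N" using real_arch_simple by blast
    then show ?thesis by (intro exI[of _ N]) auto
  qed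
  have "(\<lambda>n. \<psi> (\<lambda>\<omega>. f \<omega> - min (f \<omega>) (real n))) \<longlonglongrightarrow> 0"
  proof (rule daniell)
    show "(\<lambda>\<omega>. f \<omega> - min (f \<omega>) (real n)) \<in> VC" for n by (intro VC_intros mV f)
    show "(\<lambda>n. f \<omega> - min (f \<omega>) (real n)) \<longlonglongrightarrow> 0" for \<omega>
    proof -
      obtain N where N: "\<forall>n\<ge>N. min (f \<omega>) (real n) = f \<omega>" using conv by blast
      then show ?thesis by (intro tendsto_eventually eventually_sequentiallyI[of N]) simp
    qed
  qed auto
  then have "(\<lambda>n. \<psi> f - \<psi> (\<lambda>\<omega>. f \<omega> - min (f \<omega>) (real n))) \<longlonglongrightarrow> \<psi> f - 0"
    by (intro tendsto_intros)
  then have "(\<lambda>n. ennreal (\<psi> (\<lambda>\<omega>. min (f \<omega>) (real n)))) \<longlonglongrightarrow> ennreal (\<psi> f)"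
    using psi_diff[OF f mV] by (intro tendsto_ennrealI) simp
  then have lim1: "(\<lambda>n. \<integral>\<^sup>+\<omega>. ennreal (min (f \<omega>) (real n)) \<partial>P) \<longlonglongrightarrow> ennreal (\<psi> f)"
    by (simp add: eq)
  have "(\<lambda>n. \<integral>\<^sup>+\<omega>. ennreal (min (f \<omega>) (real n)) \<partial>P) \<longlonglongrightarrow> (\<integral>\<^sup>+\<omega>. ennreal (f \<omega>) \<partial>P)"
  proof (rule nn_integral_LIMSEQ)
    show "incseq (\<lambda>n \<omega>. ennreal (min (f \<omega>) (real n)))"
      by (intro incseq_SucI le_funI ennreal_leI) simp
    show "(\<lambda>\<omega>. ennreal (min (f \<omega>) (real n))) \<in> borel_measurable P" for n
      using VC_measurable_P[OF mV] by simp
    show "(\<lambda>n. ennreal (min (f \<omega>) (real n))) \<longlonglongrightarrow> ennreal (f \<omega>)" for \<omega>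
    proof -
      obtain N where N: "\<forall>n\<ge>N. min (f \<omega>) (real n) = f \<omega>" using conv by blast
      then show ?thesis by (intro tendsto_eventually eventually_sequentiallyI[of N]) simp
    qed
  qed
  from LIMSEQ_unique[OF this lim1] show ?thesis .
qed

lemma P_in_PZ: "P \<in> PZ \<Omega> Z"
proof -
  have "(\<integral>\<^sup>+\<omega>. ennreal (Z \<omega>) \<partial>P) = ennreal (\<psi> Z)"
    using Z_ge1 by (intro integral_P_nonneg VC_Z) force
  then show ?thesis using prob_P sets_P by (simp add: PZ_def)
qed

lemma integral_P:
  assumes f: "f \<in> VC"
  shows "integral\<^sup>L P f = \<psi> f"
proof -
  have nonneg: "integrable P g \<and> integral\<^sup>L P g = \<psi> g" if g: "g \<in> VC" "\<And>\<omega>. \<omega> \<in> \<Omega> \<Longrightarrow> 0 \<le> g \<omega>" for g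
  proof -
    have eq: "(\<integral>\<^sup>+\<omega>. ennreal (g \<omega>) \<partial>P) = ennreal (\<psi> g)" by (rule integral_P_nonneg[OF g])
    have ae: "AE \<omega> in P. 0 \<le> g \<omega>" using g(2) by (auto simp: space_P intro!: AE_I2)
    have "integrable P g"
      using eq ae VC_measurable_P[OF g(1)] by (intro integrableI_nonneg) auto
    moreover have "integral\<^sup>L P g = \<psi> g"
      using integral_eq_nn_integral[OF VC_measurable_P[OF g(1)] ae] eq psi_nonneg[OF g] by simp
    ultimately show ?thesis by simp
  qed
  let ?p = "\<lambda>\<omega>. max (f \<omega>) 0" and ?n = "\<lambda>\<omega>. max (- f \<omega>) 0"
  have V: "?p \<in> VC" "?n \<in> VC" by (intro VC_max VC_const VC_intros f)+
  have dec: "f = (\<lambda>\<omega>. ?p \<omega> - ?n \<omega>)" by (auto simp: max_def)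
  have "integral\<^sup>L P (\<lambda>\<omega>. ?p \<omega> - ?n \<omega>) = integral\<^sup>L P ?p - integral\<^sup>L P ?n"
    using nonneg[OF V(1)] nonneg[OF V(2)] by (intro Bochner_Integration.integral_diff) auto
  also have "\<dots> = \<psi> (\<lambda>\<omega>. ?p \<omega> - ?n \<omega>)"
    using nonneg[OF V(1)] nonneg[OF V(2)] psi_diff[OF V] by simp
  finally show ?thesis using dec by simp
qed

end

section \<open>Dini's theorem and approximation of semicontinuous functions from above\<close>

lemma dini_zero:
  fixes f :: "nat \<Rightarrow> 'a::metric_space \<Rightarrow> real"
  assumes K: "compact K" and cont: "\<And>n. continuous_on K (f n)"
    and dec: "\<And>n \<omega>. \<omega> \<in> K \<Longrightarrow> f (Suc n) \<omega> \<le> f n \<omega>"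
    and lim: "\<And>\<omega>. \<omega> \<in> K \<Longrightarrow> (\<lambda>n. f n \<omega>) \<longlonglongrightarrow> 0" and e: "e > 0"
  shows "\<exists>N. \<forall>n\<ge>N. \<forall>\<omega>\<in>K. f n \<omega> < e"
proof -
  \<comment> \<open>The sets where \<open>f n < e\<close> are relatively open in K and are extended
    to open sets for the covering argument. They increase with n, so the largest index of a finite
    subcover serves for all later n.\<close>
  have "\<exists>T. open T \<and> K \<inter> f n -` {..<e} = K \<inter> T" for n
    using continuous_openin_preimage_gen[OF cont, of "{..<e}" n] by (auto simp: openin_open)
  then obtain T where T: "\<And>n. open (T n)" "\<And>n. K \<inter> f n -` {..<e} = K \<inter> T n" by metis
  have "K \<subseteq> (\<Union>n. T n)"
  proof
    fix \<omega> assume w: "\<omega> \<in> K"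
    obtain n where "f n \<omega> < e"
      using order_tendstoD(2)[OF lim[OF w] e] by (auto simp: eventually_sequentially)
    then show "\<omega> \<in> (\<Union>n. T n)" using T(2)[of n] w by auto
  qed
  then obtain F where F: "finite F" "K \<subseteq> (\<Union>n\<in>F. T n)"
    using compactE_image[OF K, of UNIV T] T(1) by auto
  show ?thesis
  proof (intro exI allI ballI impI)
    \<comment> \<open>Inserting 0 keeps \<open>Max\<close> meaningful if F is empty, which can
      happen when K is.\<close>
    fix n \<omega> assume n: "Max (insert 0 F) \<le> n" and w: "\<omega> \<in> K"
    then obtain m where m: "m \<in> F" "\<omega> \<in> T m" using F by auto
    then have "f m \<omega> < e" using T(2)[of m] w by auto
    moreover have "m \<le> n" using m(1) n F(1) by (meson Max_ge finite.insertI insertI2 order_trans)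
    then have "f n \<omega> \<le> f m \<omega>" by (rule lift_Suc_antimono_le[of "\<lambda>n. f n \<omega>", OF dec[OF w]])
    ultimately show "f n \<omega> < e" by simp
  qed
qed

context weighted_space
begin

lemma BZ_VB: "X \<in> BZ \<Omega> Z \<Longrightarrow> X \<in> VB"
proof -
  assume X: "X \<in> BZ \<Omega> Z"
  then obtain c where c: "\<forall>\<omega>\<in>\<Omega>. \<bar>X \<omega> / Z \<omega>\<bar> \<le> c" by (auto simp: BZ_def)
  have "\<bar>X \<omega>\<bar> \<le> c * Z \<omega>" if "\<omega> \<in> \<Omega>" for \<omega>
  proof -
    have "Z \<omega> > 0" using Z_ge1 that by force
    moreover have "\<bar>X \<omega>\<bar> / Z \<omega> \<le> c" using c that \<open>Z \<omega> > 0\<close> by (auto simp: abs_div)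
    ultimately show ?thesis by (simp add: field_simps)
  qed
  then show ?thesis using X by (auto simp: BZ_def Bset_def VB_def)
qed

lemma VB_BZ: "X \<in> VB \<Longrightarrow> restrict X \<Omega> \<in> BZ \<Omega> Z"
proof -
  assume X: "X \<in> VB"
  then obtain c where c: "\<forall>\<omega>\<in>\<Omega>. \<bar>X \<omega>\<bar> \<le> c * Z \<omega>" by (auto simp: VB_def)
  have "\<bar>X \<omega> / Z \<omega>\<bar> \<le> c" if "\<omega> \<in> \<Omega>" for \<omega>
  proof -
    have "Z \<omega> > 0" using Z_ge1 that by force
    then show ?thesis using c that by (simp add: abs_div field_simps)
  qed
  moreover have "restrict X \<Omega> \<in> borel_measurable (restrict_space borel \<Omega>)"
    using X by (subst measurable_cong[of _ _ X]) (auto simp: VB_def space_restrict_space)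
  ultimately show ?thesis by (auto simp: BZ_def Bset_def)
qed

lemma CZ_VC: "X \<in> CZ \<Omega> Z \<Longrightarrow> X \<in> VC"
  using BZ_VB[of X] by (auto simp: CZ_def VC_def VB_def)

lemma VC_CZ: "X \<in> VC \<Longrightarrow> restrict X \<Omega> \<in> CZ \<Omega> Z"
  using VB_BZ[of X] VC_subset_VB VC_continuous[of X]
  by (auto simp: CZ_def cong: continuous_on_cong_simp)

lemma UZ_VB: "X \<in> UZ \<Omega> Z \<Longrightarrow> X \<in> VB"
  using BZ_VB by (simp add: UZ_def)

lemma CZ_UZ: "X \<in> CZ \<Omega> Z \<Longrightarrow> X \<in> UZ \<Omega> Z"
  using VC_openin_less[OF CZ_VC] by (auto simp: UZ_def usc_on_def CZ_def)

lemma PZ_D: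
  assumes "Q \<in> PZ \<Omega> Z"
  shows "prob_space Q" "sets Q = sets (restrict_space borel \<Omega>)" "space Q = \<Omega>"
  using assms sets_eq_imp_space_eq[of Q "restrict_space borel \<Omega>"]
  by (auto simp: PZ_def space_restrict_space)

lemma integral_restrict:
  assumes "Q \<in> PZ \<Omega> Z"
  shows "integral\<^sup>L Q (restrict X \<Omega>) = integral\<^sup>L Q X"
  by (intro Bochner_Integration.integral_cong) (auto simp: PZ_D[OF assms])

lemma VB_integrable:
  assumes Q: "Q \<in> PZ \<Omega> Z" and X: "X \<in> VB"
  shows "integrable Q X"
proof -
  have meas: "Y \<in> borel_measurable Q" if "Y \<in> VB" for Y
    using that measurable_cong_sets[OF PZ_D(2)[OF Q] refl] by (auto simp: VB_def)
  have ZB: "Z \<in> VB" using VC_Z VC_subset_VB by blast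
  have "integrable Q Z"
    using Q Z_ge1 by (intro integrableI_nonneg meas[OF ZB] AE_I2) (force simp: PZ_D[OF Q] PZ_def)+
  obtain c where c: "\<forall>\<omega>\<in>\<Omega>. \<bar>X \<omega>\<bar> \<le> c * Z \<omega>" using X by (auto simp: VB_def)
  show ?thesis
  proof (rule Bochner_Integration.integrable_bound)
    show "integrable Q (\<lambda>\<omega>. c * Z \<omega>)" using \<open>integrable Q Z\<close> by simp
    show "AE \<omega> in Q. norm (X \<omega>) \<le> norm (c * Z \<omega>)"
      using c by (intro AE_I2) (force simp: PZ_D[OF Q])
  qed (rule meas[OF X])
qed

lemma integral_mono_VB:
  assumes "Q \<in> PZ \<Omega> Z" "X \<in> VB" "Y \<in> VB" "\<And>\<omega>. \<omega> \<in> \<Omega> \<Longrightarrow> X \<omega> \<le> Y \<omega>"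
  shows "integral\<^sup>L Q X \<le> integral\<^sup>L Q Y"
  using assms by (intro integral_mono VB_integrable) (auto simp: PZ_D[OF assms(1)])

text \<open>The sup-convolutions \<open>x \<mapsto> sup {W y - n * dist x y | y}\<close> of the nonpositive upper
  semicontinuous function \<open>W = X - c Z\<close> are Lipschitz and decrease to W.\<close>

lemma usc_approx:
  assumes X: "X \<in> UZ \<Omega> Z"
  shows "\<exists>Y c. (\<forall>n. Y n \<in> VC) \<and> (\<forall>n. \<forall>\<omega>\<in>\<Omega>. X \<omega> \<le> Y n \<omega> \<and> \<bar>Y n \<omega>\<bar> \<le> c * Z \<omega>)
    \<and> (\<forall>\<omega>\<in>\<Omega>. (\<lambda>n::nat. Y n \<omega>) \<longlonglongrightarrow> X \<omega>)"
proof -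
  obtain c where c: "\<forall>\<omega>\<in>\<Omega>. \<bar>X \<omega>\<bar> \<le> c * Z \<omega>" using UZ_VB[OF X] by (auto simp: VB_def)
  have usc: "openin (top_of_set \<Omega>) {\<omega>\<in>\<Omega>. X \<omega> < r}" for r
    using X by (simp add: UZ_def usc_on_def)
  \<comment> \<open>Subtracting the multiple of Z that bounds X makes W nonpositive, so the suprema
    below are finite and at most 0; the same multiple is added back in \<open>Y\<close>.\<close>
  define W where "W \<omega> = X \<omega> - c * Z \<omega>" for \<omega>
  have W0: "W \<omega> \<le> 0" if "\<omega> \<in> \<Omega>" for \<omega> using c that by (force simp: W_def)
  define S where "S n x = (SUP y\<in>\<Omega>. W y - real n * dist x y)" for n x
  have bdd: "bdd_above ((\<lambda>y. W y - real n * dist x y) ` \<Omega>)" for n x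
  proof (rule bdd_aboveI2)
    fix y assume "y \<in> \<Omega>"
    then show "W y - real n * dist x y \<le> 0" using W0[of y] by (smt (verit) of_nat_0_le_iff zero_le_dist mult_nonneg_nonneg)
  qed
  have S_upper: "W y - real n * dist x y \<le> S n x" if "y \<in> \<Omega>" for n x y
    unfolding S_def by (rule cSUP_upper[OF that bdd])
  have S_least: "S n x \<le> r" if "\<And>y. y \<in> \<Omega> \<Longrightarrow> W y - real n * dist x y \<le> r" for n x r
    unfolding S_def by (rule cSUP_least[OF Omega_ne that])
  have SW: "W x \<le> S n x" if "x \<in> \<Omega>" for n x using S_upper[OF that, of n x] by simp
  have S0: "S n x \<le> 0" for n x
  proof (rule S_least)
    fix y assume "y \<in> \<Omega>"
    then show "W y - real n * dist x y \<le> 0" using W0[of y] by (smt (verit) of_nat_0_le_iff zero_le_dist mult_nonneg_nonneg)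
  qed
  have lip: "S n x \<le> S n x' + real n * dist x x'" for n x x'
  proof (rule S_least)
    fix y assume y: "y \<in> \<Omega>"
    have "real n * dist x' y \<le> real n * (dist x x' + dist x y)"
      using dist_triangle[of x' y x] by (intro mult_left_mono) (auto simp: dist_commute)
    then show "W y - real n * dist x y \<le> S n x' + real n * dist x x'"
      using S_upper[OF y, of n x'] by (simp add: algebra_simps)
  qed
  have contS: "continuous_on \<Omega> (S n)" for n
  proof (rule lipschitz_on_continuous_on[of "real n"], rule lipschitz_onI)
    show "dist (S n x) (S n y) \<le> real n * dist x y" for x y
      using lip[of n x y] lip[of n y x] by (simp add: dist_real_def dist_commute abs_le_iff)
  qed simp
  define Y where "Y n \<omega> = S n \<omega> + c * Z \<omega>" for n \<omega>
  have bnd: "X \<omega> \<le> Y n \<omega> \<and> \<bar>Y n \<omega>\<bar> \<le> c * Z \<omega>" if "\<omega> \<in> \<Omega>" for n \<omega>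
  proof -
    have "\<bar>X \<omega>\<bar> \<le> c * Z \<omega>" using c that by blast
    then show ?thesis using SW[OF that, of n] S0[of n \<omega>] by (auto simp: Y_def W_def)
  qed
  have YV: "Y n \<in> VC" for n
  proof -
    have "continuous_on \<Omega> (Y n)" unfolding Y_def by (intro continuous_intros contS Z_cont)
    then show ?thesis using bnd[of _ n] unfolding VC_def by blast
  qed
  have lim: "(\<lambda>n. Y n x) \<longlonglongrightarrow> X x" if x: "x \<in> \<Omega>" for x
  proof (rule LIMSEQ_I)
    fix r :: real assume r: "0 < r"
    \<comment> \<open>Semicontinuity of X and continuity of Z contribute r/4 each, so W rises by at
      most r/2 near x.\<close>
    let ?N = "{\<omega>\<in>\<Omega>. X \<omega> < X x + r / 4} \<inter> {\<omega>\<in>\<Omega>. (- c) * Z \<omega> < (- c) * Z x + r / 4}"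
    have "openin (top_of_set \<Omega>) ?N"
      by (intro openin_Int usc VC_openin_less fun_subspace_scale[OF VC_subspace VC_Z])
    moreover have "x \<in> ?N" using x r by simp
    ultimately obtain d where d: "d > 0" "\<And>y. y \<in> \<Omega> \<Longrightarrow> dist y x < d \<Longrightarrow> y \<in> ?N"
      unfolding openin_euclidean_subtopology_iff by blast
    \<comment> \<open>For n >= M the penalty at distance d or more exceeds -W x, and since W <= 0
      such far points stay below W x.\<close>
    obtain M :: nat where M: "- W x / d < real M" using reals_Archimedean2 by blast
    have "norm (Y n x - X x) < r" if n: "n \<ge> M" for n
    proof -
      have "S n x \<le> W x + r / 2"
      proof (rule S_least)
        fix y assume y: "y \<in> \<Omega>"
        show "W y - real n * dist x y \<le> W x + r / 2"
        proof (cases "dist y x < d")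
          case True
          from d(2)[OF y this] have "W y \<le> W x + r / 2" by (simp add: W_def)
          moreover have "0 \<le> real n * dist x y" by simp
          ultimately show ?thesis by linarith
        next
          case False
          have "- W x < real M * d" using M d(1) by (simp add: field_simps)
          also have "\<dots> \<le> real n * dist x y"
            using n False d(1) by (intro mult_mono) (auto simp: dist_commute)
          finally show ?thesis using W0[OF y] r by linarith
        qed
      qed
      then show ?thesis using SW[OF x, of n] r by (simp add: Y_def W_def)
    qed
    then show "\<exists>no. \<forall>n\<ge>no. norm (Y n x - X x) < r" by blast
  qed
  show ?thesis
    by (rule exI[of _ Y], rule exI[of _ c]) (use YV bnd lim in blast)
qed

end

section \<open>Superhedging duality\<close>

locale superhedging = weighted_space \<Omega> Z
  for \<Omega> :: "'a::polish_space set" and Z :: "'a \<Rightarrow> real" +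
  fixes A G :: "('a \<Rightarrow> real) set"
  assumes G_sub: "G \<subseteq> Bset \<Omega>"
    and G_0: "cst \<Omega> 0 \<in> G"
    and A_sub: "A \<subseteq> Bset \<Omega>"
    and A_Bplus: "Bplus \<Omega> \<subseteq> A"
    and A_add: "setsum \<Omega> A (Bplus \<Omega>) \<subseteq> A"
    and AG_convex: "fconvex \<Omega> (setdiff \<Omega> A G)"
    and C: "\<forall>n::nat. n \<ge> 1 \<longrightarrow> (\<exists>z::real. z \<ge> 0 \<and>
              restrict (\<lambda>\<omega>. real n * max (Z \<omega> - z) 0 - 1 / real n) \<Omega> \<in> setdiff \<Omega> G A)"
begin

abbreviation M where "M \<equiv> borel_measurable (restrict_space borel \<Omega>)"

text \<open>Membership in A - G as a property of the values on \<open>\<Omega>\<close> alone, which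
  spares the later arguments the extensional representation.\<close>

definition acceptable :: "('a \<Rightarrow> real) \<Rightarrow> bool" where
  "acceptable X \<longleftrightarrow> restrict X \<Omega> \<in> setdiff \<Omega> A G"

lemma acceptable_cong: "(\<And>\<omega>. \<omega> \<in> \<Omega> \<Longrightarrow> X \<omega> = Y \<omega>) \<Longrightarrow> acceptable X \<longleftrightarrow> acceptable Y"
  unfolding acceptable_def by (metis restrict_ext)

lemma restrict_M: "restrict X \<Omega> \<in> M \<longleftrightarrow> X \<in> M"
  by (rule measurable_cong) (simp add: space_restrict_space)

lemma restrict_Bset: "X \<in> M \<Longrightarrow> restrict X \<Omega> \<in> Bset \<Omega>"
  unfolding Bset_def using restrict_M[of X] by blast

lemma acceptable_iff: "acceptable X \<longleftrightarrow> (\<exists>a\<in>A. \<exists>g\<in>G. \<forall>\<omega>\<in>\<Omega>. X \<omega> = a \<omega> - g \<omega>)"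
proof
  assume "acceptable X"
  then obtain a g where "a \<in> A" "g \<in> G" "restrict X \<Omega> = restrict (\<lambda>\<omega>. a \<omega> - g \<omega>) \<Omega>"
    unfolding acceptable_def setdiff_def by blast
  then show "\<exists>a\<in>A. \<exists>g\<in>G. \<forall>\<omega>\<in>\<Omega>. X \<omega> = a \<omega> - g \<omega>" by (metis restrict_apply')
next
  assume "\<exists>a\<in>A. \<exists>g\<in>G. \<forall>\<omega>\<in>\<Omega>. X \<omega> = a \<omega> - g \<omega>"
  then obtain a g where "a \<in> A" "g \<in> G" "\<And>\<omega>. \<omega> \<in> \<Omega> \<Longrightarrow> X \<omega> = a \<omega> - g \<omega>" by blast
  then have "restrict X \<Omega> = restrict (\<lambda>\<omega>. a \<omega> - g \<omega>) \<Omega>" by (auto intro: restrict_ext)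
  then show "acceptable X" unfolding acceptable_def setdiff_def using \<open>a \<in> A\<close> \<open>g \<in> G\<close> by blast
qed

lemma acceptable_uminus_iff: "restrict X \<Omega> \<in> setdiff \<Omega> G A \<longleftrightarrow> acceptable (\<lambda>\<omega>. - X \<omega>)"
proof
  assume "restrict X \<Omega> \<in> setdiff \<Omega> G A"
  then obtain a g where *: "a \<in> A" "g \<in> G" "restrict X \<Omega> = restrict (\<lambda>\<omega>. g \<omega> - a \<omega>) \<Omega>"
    unfolding setdiff_def by blast
  have "X \<omega> = g \<omega> - a \<omega>" if "\<omega> \<in> \<Omega>" for \<omega>
    using fun_cong[OF *(3), of \<omega>] that by simp
  then have "\<forall>\<omega>\<in>\<Omega>. - X \<omega> = a \<omega> - g \<omega>" by simp
  then show "acceptable (\<lambda>\<omega>. - X \<omega>)" unfolding acceptable_iff using * by blast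
next
  assume "acceptable (\<lambda>\<omega>. - X \<omega>)"
  then obtain a g where *: "a \<in> A" "g \<in> G" "\<forall>\<omega>\<in>\<Omega>. - X \<omega> = a \<omega> - g \<omega>"
    unfolding acceptable_iff by blast
  then have "restrict X \<Omega> = restrict (\<lambda>\<omega>. g \<omega> - a \<omega>) \<Omega>" by (intro restrict_ext) force
  then show "restrict X \<Omega> \<in> setdiff \<Omega> G A" unfolding setdiff_def using * by blast
qed

lemma setdiff_GA_acceptable: "X \<in> setdiff \<Omega> G A \<longleftrightarrow> X \<in> extensional \<Omega> \<and> acceptable (\<lambda>\<omega>. - X \<omega>)"
proof -
  have "X \<in> extensional \<Omega>" if "X \<in> setdiff \<Omega> G A" using that by (auto simp: setdiff_def)
  then show ?thesis using acceptable_uminus_iff[of X] by (auto simp: extensional_restrict)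
qed

lemma acceptable_M: "acceptable X \<Longrightarrow> X \<in> M"
proof -
  assume "acceptable X"
  then obtain a g where "a \<in> A" "g \<in> G" and eq: "\<And>\<omega>. \<omega> \<in> \<Omega> \<Longrightarrow> X \<omega> = a \<omega> - g \<omega>"
    unfolding acceptable_iff by blast
  then have "a \<in> M" "g \<in> M" using A_sub G_sub by (auto simp: Bset_def)
  then have "(\<lambda>\<omega>. a \<omega> - g \<omega>) \<in> M" by simp
  then show ?thesis using eq by (subst measurable_cong) (auto simp: space_restrict_space)
qed

text \<open>The increment Y - X lies in \<open>Bplus\<close> and is absorbed into the
  A-component.\<close>

lemma acceptable_mono:
  assumes X: "acceptable X" and Y: "Y \<in> M" and le: "\<And>\<omega>. \<omega> \<in> \<Omega> \<Longrightarrow> X \<omega> \<le> Y \<omega>"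
  shows "acceptable Y"
proof -
  obtain a g where ag: "a \<in> A" "g \<in> G" and eq: "\<And>\<omega>. \<omega> \<in> \<Omega> \<Longrightarrow> X \<omega> = a \<omega> - g \<omega>"
    using X unfolding acceptable_iff by blast
  define b where "b = restrict (\<lambda>\<omega>. Y \<omega> - X \<omega>) \<Omega>"
  have "b \<in> Bplus \<Omega>"
    unfolding Bplus_def b_def using acceptable_M[OF X] Y le by (auto intro!: restrict_Bset)
  then have "restrict (\<lambda>\<omega>. a \<omega> + b \<omega>) \<Omega> \<in> A"
    using A_add ag(1) unfolding setsum_def by blast
  moreover have "\<forall>\<omega>\<in>\<Omega>. Y \<omega> = restrict (\<lambda>\<omega>. a \<omega> + b \<omega>) \<Omega> \<omega> - g \<omega>"
    using eq by (simp add: b_def)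
  ultimately show ?thesis unfolding acceptable_iff using ag(2) by blast
qed

lemma acceptable_nonneg:
  assumes "Y \<in> M" "\<And>\<omega>. \<omega> \<in> \<Omega> \<Longrightarrow> 0 \<le> Y \<omega>"
  shows "acceptable Y"
proof -
  have "restrict Y \<Omega> \<in> A"
    using A_Bplus assms restrict_Bset by (auto simp: Bplus_def)
  moreover have "\<forall>\<omega>\<in>\<Omega>. Y \<omega> = restrict Y \<Omega> \<omega> - cst \<Omega> 0 \<omega>" by (simp add: cst_def)
  ultimately show ?thesis unfolding acceptable_iff using G_0 by blast
qed

lemma acceptable_convex:
  assumes "acceptable X" "acceptable Y" "0 \<le> t" "t \<le> 1"
  shows "acceptable (\<lambda>\<omega>. t * X \<omega> + (1 - t) * Y \<omega>)"
proof -
  have "restrict (\<lambda>\<omega>. t * restrict X \<Omega> \<omega> + (1 - t) * restrict Y \<Omega> \<omega>) \<Omega> \<in> setdiff \<Omega> A G"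
    using AG_convex assms unfolding fconvex_def acceptable_def by blast
  then show ?thesis
    unfolding acceptable_def by (rule back_subst[of "\<lambda>x. x \<in> setdiff \<Omega> A G"]) (auto intro: restrict_ext)
qed

section \<open>The superhedging functional\<close>

abbreviation \<phi> where "\<phi> \<equiv> phi \<Omega> A G"

lemma phi_acceptable: "\<phi> X = Inf (ereal ` {m. acceptable (\<lambda>\<omega>. m - X \<omega>)})"
  by (simp add: phi_def acceptable_def)

lemma phi_cong:
  assumes "\<And>\<omega>. \<omega> \<in> \<Omega> \<Longrightarrow> X \<omega> = Y \<omega>"
  shows "\<phi> X = \<phi> Y"
proof -
  have "acceptable (\<lambda>\<omega>. m - X \<omega>) \<longleftrightarrow> acceptable (\<lambda>\<omega>. m - Y \<omega>)" for m by (rule acceptable_cong) (simp add: assms)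
  then show ?thesis by (simp add: phi_acceptable)
qed

lemma phi_restrict: "\<phi> (restrict X \<Omega>) = \<phi> X"
  by (rule phi_cong) simp

lemma phi_le: "acceptable (\<lambda>\<omega>. m - X \<omega>) \<Longrightarrow> \<phi> X \<le> ereal m"
  unfolding phi_acceptable by (rule Inf_lower) simp

text \<open>The infimum defining \<open>\<phi>\<close> need not be attained, but acceptable capitals
  are upward closed, so every m strictly above it works. This is the source of the slack e in later
  estimates.\<close>

lemma acceptable_of_phi_less:
  assumes "\<phi> X < ereal m" "X \<in> M"
  shows "acceptable (\<lambda>\<omega>. m - X \<omega>)"
proof -
  obtain k where k: "acceptable (\<lambda>\<omega>. k - X \<omega>)" "k < m"
    using assms(1) unfolding phi_acceptable Inf_less_iff by auto
  show ?thesis by (rule acceptable_mono[OF k(1)]) (use assms(2) k(2) in auto)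
qed

lemma phi_mono:
  assumes "X \<in> M" "\<And>\<omega>. \<omega> \<in> \<Omega> \<Longrightarrow> X \<omega> \<le> Y \<omega>"
  shows "\<phi> X \<le> \<phi> Y"
  unfolding phi_acceptable
proof (rule Inf_superset_mono, rule image_mono, safe)
  fix m assume "acceptable (\<lambda>\<omega>. m - Y \<omega>)"
  then show "acceptable (\<lambda>\<omega>. m - X \<omega>)" by (rule acceptable_mono) (use assms in auto)
qed

lemma phi_0_le: "\<phi> (\<lambda>_. 0) \<le> 0"
  using phi_le[of 0 "\<lambda>_. 0"] acceptable_nonneg[of "\<lambda>_. 0"] by (simp add: zero_ereal_def)

text \<open>An X in G - A bounded below by \<epsilon> makes the constant -\<epsilon> acceptable,
  which pushes \<open>\<phi>\<close> at 0 below zero; conversely an acceptable negative constant is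
  itself an arbitrage up to sign.\<close>

lemma no_arbitrage_iff:
  "(\<not> (\<exists>X\<in>setdiff \<Omega> G A. \<exists>\<epsilon>::real. \<epsilon> > 0 \<and> (\<forall>\<omega>\<in>\<Omega>. X \<omega> \<ge> \<epsilon>))) \<longleftrightarrow> \<phi> (\<lambda>_. 0) = 0"
proof
  assume na: "\<not> (\<exists>X\<in>setdiff \<Omega> G A. \<exists>\<epsilon>::real. \<epsilon> > 0 \<and> (\<forall>\<omega>\<in>\<Omega>. X \<omega> \<ge> \<epsilon>))"
  show "\<phi> (\<lambda>_. 0) = 0"
  proof (rule antisym[OF phi_0_le], rule ccontr)
    assume "\<not> 0 \<le> \<phi> (\<lambda>_. 0)"
    then have "\<phi> (\<lambda>_. 0) < ereal 0" by (simp add: zero_ereal_def)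
    then obtain m where m: "m < 0" "acceptable (\<lambda>\<omega>. m - 0)" unfolding phi_acceptable Inf_less_iff by auto
    have "restrict (\<lambda>_. - m) \<Omega> \<in> setdiff \<Omega> G A"
      unfolding acceptable_uminus_iff using m(2) by simp
    moreover have "\<forall>\<omega>\<in>\<Omega>. restrict (\<lambda>_. - m) \<Omega> \<omega> \<ge> - m" by simp
    ultimately show False using na m(1) by (metis neg_0_less_iff_less)
  qed
next
  assume 0: "\<phi> (\<lambda>_. 0) = 0"
  show "\<not> (\<exists>X\<in>setdiff \<Omega> G A. \<exists>\<epsilon>::real. \<epsilon> > 0 \<and> (\<forall>\<omega>\<in>\<Omega>. X \<omega> \<ge> \<epsilon>))"
  proof safe
    fix X \<epsilon> assume X: "X \<in> setdiff \<Omega> G A" and e: "0 < \<epsilon>" "\<forall>\<omega>\<in>\<Omega>. X \<omega> \<ge> \<epsilon>"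
    have "acceptable (\<lambda>\<omega>. - \<epsilon> - 0)"
      by (rule acceptable_mono[of "\<lambda>\<omega>. - X \<omega>"]) (use X e setdiff_GA_acceptable in auto)
    from phi_le[OF this] 0 e(1) show False by (simp add: zero_ereal_def)
  qed
qed

lemma phistar_upper:
  assumes "Y \<in> VC" and Q: "Q \<in> PZ \<Omega> Z"
  shows "ereal (integral\<^sup>L Q Y) - \<phi> Y \<le> phistar \<Omega> Z A G Q"
proof -
  have "ereal (integral\<^sup>L Q (restrict Y \<Omega>)) - \<phi> (restrict Y \<Omega>) \<le> phistar \<Omega> Z A G Q"
    unfolding phistar_def by (rule SUP_upper[OF VC_CZ[OF assms(1)]])
  then show ?thesis by (simp add: integral_restrict[OF Q] phi_restrict)
qed

lemma acceptable_weight: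
  assumes "n \<ge> 1"
  shows "\<exists>z\<ge>0. acceptable (\<lambda>\<omega>. 1 / real n - real n * max (Z \<omega> - z) 0)"
proof -
  obtain z where "z \<ge> 0" "restrict (\<lambda>\<omega>. real n * max (Z \<omega> - z) 0 - 1 / real n) \<Omega> \<in> setdiff \<Omega> G A"
    using C assms by blast
  then show ?thesis unfolding acceptable_uminus_iff by (intro exI[of _ z]) simp
qed

lemma VB_M: "X \<in> VB \<Longrightarrow> X \<in> M"
  by (simp add: VB_def)

lemma VB_const: "(\<lambda>_. m) \<in> VB"
  using VC_const VC_subset_VB by blast

text \<open>On \<open>\<Omega>\<close> one has X <= n Z <= n z + n (Z - z)^+ for large n, and by (C)
  the last term is hedged at cost 1/n. The successor in the choice of n ensures n >= 1, as (C)
  requires.\<close>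

lemma phi_less_top: "X \<in> VB \<Longrightarrow> \<phi> X < \<infinity>"
proof -
  assume X: "X \<in> VB"
  then obtain c where c: "\<forall>\<omega>\<in>\<Omega>. \<bar>X \<omega>\<bar> \<le> c * Z \<omega>" by (auto simp: VB_def)
  obtain n0 :: nat where n0: "c \<le> real n0" using real_arch_simple by blast
  define n where "n = Suc n0"
  obtain z where z: "z \<ge> 0" "acceptable (\<lambda>\<omega>. 1 / real n - real n * max (Z \<omega> - z) 0)"
    using acceptable_weight[of n] by (auto simp: n_def)
  have "acceptable (\<lambda>\<omega>. (real n * z + 1 / real n) - X \<omega>)"
  proof (rule acceptable_mono[OF z(2)])
    show "(\<lambda>\<omega>. (real n * z + 1 / real n) - X \<omega>) \<in> M" using VB_M[OF X] by simp
    fix \<omega> assume w: "\<omega> \<in> \<Omega>"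
    have "X \<omega> \<le> c * Z \<omega>" using c w by fastforce
    also have "\<dots> \<le> real n * Z \<omega>" using n0 Z_ge1 w by (intro mult_right_mono) (auto simp: n_def intro: order_trans[of 0 1])
    also have "\<dots> \<le> real n * (z + max (Z \<omega> - z) 0)" by (intro mult_left_mono) auto
    finally show "1 / real n - real n * max (Z \<omega> - z) 0 \<le> (real n * z + 1 / real n) - X \<omega>"
      by (simp add: algebra_simps)
  qed
  from phi_le[OF this] show ?thesis by (rule le_less_trans) simp
qed

end

section \<open>Dual representation in the absence of arbitrage\<close>

locale no_arbitrage = superhedging +
  assumes phi_0: "phi \<Omega> A G (\<lambda>_. 0) = 0"
begin

lemma phi_finite:
  assumes X: "X \<in> VB"
  shows "\<bar>\<phi> X\<bar> \<noteq> \<infinity>"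
proof -
  have "\<phi> X \<noteq> -\<infinity>"
  proof
    assume inf: "\<phi> X = -\<infinity>"
    have nX: "(\<lambda>\<omega>. - X \<omega>) \<in> VB" by (rule fun_subspace_minus[OF VB_subspace X])
    obtain m where "\<phi> (\<lambda>\<omega>. - X \<omega>) < ereal m" using phi_less_top[OF nX] less_PInf_Ex_of_nat by auto
    then have 1: "acceptable (\<lambda>\<omega>. m - - X \<omega>)" by (rule acceptable_of_phi_less[OF _ VB_M[OF nX]])
    \<comment> \<open>The capital -m - 2 is chosen so that the midpoint with the preceding position
      is the constant -1.\<close>
    have 2: "acceptable (\<lambda>\<omega>. (- m - 2) - X \<omega>)" by (rule acceptable_of_phi_less) (use inf VB_M[OF X] in auto)
    have "acceptable (\<lambda>\<omega>. (1/2) * (m - - X \<omega>) + (1 - 1/2) * ((- m - 2) - X \<omega>))"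
      by (rule acceptable_convex[OF 1 2]) auto
    then have "acceptable (\<lambda>\<omega>. - 1 - 0)" by (simp add: field_simps)
    from phi_le[OF this] phi_0 show False by (simp add: zero_ereal_def)
  qed
  then show ?thesis using phi_less_top[OF X] by auto
qed

definition \<rho> :: "('a \<Rightarrow> real) \<Rightarrow> real" where "\<rho> X = real_of_ereal (\<phi> X)"

lemma phi_rho: "X \<in> VB \<Longrightarrow> \<phi> X = ereal (\<rho> X)"
  using phi_finite by (simp add: \<rho>_def ereal_real)

lemma rho_le: "X \<in> VB \<Longrightarrow> acceptable (\<lambda>\<omega>. m - X \<omega>) \<Longrightarrow> \<rho> X \<le> m"
  using phi_le[of m X] phi_rho[of X] by simp

lemma acceptable_rho: "X \<in> VB \<Longrightarrow> e > 0 \<Longrightarrow> acceptable (\<lambda>\<omega>. (\<rho> X + e) - X \<omega>)"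
  by (rule acceptable_of_phi_less) (auto simp: phi_rho VB_M)

lemma rho_mono: "X \<in> VB \<Longrightarrow> Y \<in> VB \<Longrightarrow> (\<And>\<omega>. \<omega> \<in> \<Omega> \<Longrightarrow> X \<omega> \<le> Y \<omega>) \<Longrightarrow> \<rho> X \<le> \<rho> Y"
  using phi_mono[OF VB_M, of X Y] phi_rho by simp

lemma rho_convex: "fun_convex_on VB \<rho>"
  unfolding fun_convex_on_def
proof (intro ballI allI impI)
  fix x y and t :: real assume xy: "x \<in> VB" "y \<in> VB" and t: "0 \<le> t" "t \<le> 1"
  show "\<rho> (\<lambda>w. t * x w + (1 - t) * y w) \<le> t * \<rho> x + (1 - t) * \<rho> y"
  proof (rule field_le_epsilon)
    fix e :: real assume e: "0 < e"
    have "acceptable (\<lambda>\<omega>. t * ((\<rho> x + e) - x \<omega>) + (1 - t) * ((\<rho> y + e) - y \<omega>))"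
      by (intro acceptable_convex acceptable_rho xy e t)
    then have "acceptable (\<lambda>\<omega>. (t * \<rho> x + (1 - t) * \<rho> y + e) - (t * x \<omega> + (1 - t) * y \<omega>))"
      by (simp add: algebra_simps)
    then show "\<rho> (\<lambda>w. t * x w + (1 - t) * y w) \<le> t * \<rho> x + (1 - t) * \<rho> y + e"
      by (intro rho_le VB_intros xy)
  qed
qed

lemma rho_translate: "X \<in> VB \<Longrightarrow> \<rho> (\<lambda>\<omega>. X \<omega> + m) \<le> \<rho> X + m"
proof (rule field_le_epsilon)
  fix e :: real assume X: "X \<in> VB" and e: "0 < e"
  have "acceptable (\<lambda>\<omega>. (\<rho> X + m + e) - (X \<omega> + m))" using acceptable_rho[OF X e] by (simp add: algebra_simps)
  then show "\<rho> (\<lambda>\<omega>. X \<omega> + m) \<le> \<rho> X + m + e" by (intro rho_le VB_intros VB_const X)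
qed

text \<open>Condition (C) makes every subgradient tight, so that decreasing sequences are controlled on
  a compact sublevel set of Z by Dini's theorem and off it by the tail of Z.\<close>

lemma subgradient_measure:
  assumes X: "X \<in> VB"
  shows "\<exists>L. \<exists>Q\<in>PZ \<Omega> Z. (\<forall>Y\<in>VB. L Y - \<rho> Y \<le> L X - \<rho> X) \<and> (\<forall>Y\<in>VC. integral\<^sup>L Q Y = L Y)
    \<and> (\<forall>Y\<in>VB. (\<forall>\<omega>\<in>\<Omega>. X \<omega> \<le> Y \<omega>) \<longrightarrow> L X \<le> L Y)"
proof -
  obtain L where lin: "fun_linear_on VB L" and sub: "\<And>Y. Y \<in> VB \<Longrightarrow> L Y \<le> \<rho> (\<lambda>\<omega>. X \<omega> + Y \<omega>) - \<rho> X"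
    using fun_convex_subgradient[OF VB_subspace rho_convex X] by blast
  note L_add = fun_linear_add[OF lin] and L_scale = fun_linear_scale[OF lin]
  have L_diff: "L (\<lambda>\<omega>. f \<omega> - g \<omega>) = L f - L g" if "f \<in> VB" "g \<in> VB" for f g
    using L_add[OF fun_subspace_diff[OF VB_subspace that] that(2)] by simp
  \<comment> \<open>Positivity comes from the subgradient inequality in the direction f - g <= 0,
    along which \<open>\<rho>\<close> cannot increase.\<close>
  have L_mono: "L f \<le> L g" if fg: "f \<in> VB" "g \<in> VB" "\<And>\<omega>. \<omega> \<in> \<Omega> \<Longrightarrow> f \<omega> \<le> g \<omega>" for f g
  proof -
    have d: "(\<lambda>\<omega>. f \<omega> - g \<omega>) \<in> VB" by (intro VB_intros fg)
    have "L (\<lambda>\<omega>. f \<omega> - g \<omega>) \<le> \<rho> (\<lambda>\<omega>. X \<omega> + (f \<omega> - g \<omega>)) - \<rho> X" by (rule sub[OF d])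
    moreover have "\<rho> (\<lambda>\<omega>. X \<omega> + (f \<omega> - g \<omega>)) \<le> \<rho> X"
      using fg(3) by (intro rho_mono fun_subspace_add[OF VB_subspace X d] X) auto
    ultimately show ?thesis using L_diff[OF fg(1,2)] by simp
  qed
  have subX: "L Y - \<rho> Y \<le> L X - \<rho> X" if Y: "Y \<in> VB" for Y
    using sub[OF fun_subspace_diff[OF VB_subspace Y X]] L_diff[OF Y X] by simp
  \<comment> \<open>Adding cash m raises \<open>\<rho>\<close> by at most m. As m may be negative,
    the bounds at 1 and -1 together force L 1 = 1.\<close>
  have L_const_le: "L (\<lambda>_. m) \<le> m" for m
    using sub[OF VB_const, of m] rho_translate[OF X, of m] by simp
  have L_one: "L (\<lambda>_. 1) = 1"
    using L_const_le[of 1] L_const_le[of "-1"] L_scale[OF VB_const, of "-1" 1] by simp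
  have L_const: "L (\<lambda>_. m) = m" for m using L_scale[OF VB_const, of m 1] L_one by simp
  have CB: "f \<in> VC \<Longrightarrow> f \<in> VB" for f using VC_subset_VB by blast
  \<comment> \<open>This constant gives \<open>L Y \<le> \<rho> Y + k\<close> for all Y in
    \<open>VB\<close>, at whatever scale Y is taken.\<close>
  define k where "k = \<bar>L X - \<rho> X\<bar>"
  have tail: "\<exists>z\<ge>0. L (\<lambda>\<omega>. max (Z \<omega> - z) 0) < e" if e: "e > 0" for e
  proof -
    \<comment> \<open>With 1/n bounded by 1, the tail is at most (1 + k)/n, which this choice makes
      smaller than e.\<close>
    obtain n0 :: nat where "(1 + k) / e < real n0" using reals_Archimedean2 by blast
    define n where "n = Suc n0"
    have n: "n \<ge> 1" "1 + k < e * real n"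
      using \<open>(1 + k) / e < real n0\<close> e by (auto simp: n_def field_simps)
    obtain z where z: "z \<ge> 0" "acceptable (\<lambda>\<omega>. 1 / real n - real n * max (Z \<omega> - z) 0)"
      using acceptable_weight[OF n(1)] by blast
    have T: "(\<lambda>\<omega>. max (Z \<omega> - z) 0) \<in> VB" by (intro CB VC_max VC_intros VC_const VC_Z)
    have nT: "(\<lambda>\<omega>. real n * max (Z \<omega> - z) 0) \<in> VB" by (intro VB_intros T)
    have "real n * L (\<lambda>\<omega>. max (Z \<omega> - z) 0) \<le> 1 / real n + k"
      using subX[OF nT] rho_le[OF nT z(2)] L_scale[OF T, of "real n"] unfolding k_def by linarith
    also have "\<dots> \<le> 1 + k" using n by simp
    also have "\<dots> < real n * e" using n(2) by (simp add: mult.commute)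
    finally have "L (\<lambda>\<omega>. max (Z \<omega> - z) 0) < e" using n(1) by simp
    with z(1) show ?thesis by blast
  qed
  have "daniell_functional \<Omega> Z L"
  proof (unfold_locales)
    show "fun_linear_on VC L"
      using L_add L_scale CB by (simp add: fun_linear_on_def)
    show "L f \<le> L g" if "f \<in> VC" "g \<in> VC" "\<And>\<omega>. \<omega> \<in> \<Omega> \<Longrightarrow> f \<omega> \<le> g \<omega>" for f g
      by (rule L_mono) (use that CB in auto)
    show "L (\<lambda>_. 1) = 1" by (rule L_one)
  next
    fix f :: "nat \<Rightarrow> 'a \<Rightarrow> real"
    assume fV: "\<And>n. f n \<in> VC" and dec: "\<And>n \<omega>. \<omega> \<in> \<Omega> \<Longrightarrow> f (Suc n) \<omega> \<le> f n \<omega>"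
      and lim: "\<And>\<omega>. \<omega> \<in> \<Omega> \<Longrightarrow> (\<lambda>n. f n \<omega>) \<longlonglongrightarrow> 0"
    have f0: "0 \<le> f n \<omega>" if "\<omega> \<in> \<Omega>" for n \<omega>
      by (rule decseq_ge[OF decseq_SucI lim]) (use dec that in auto)
    have Lf0: "0 \<le> L (f n)" for n
      using L_mono[OF VB_const CB[OF fV], of 0 n] f0 L_const[of 0] by simp
    obtain c0 where c0: "\<forall>\<omega>\<in>\<Omega>. \<bar>f 0 \<omega>\<bar> \<le> c0 * Z \<omega>" using fV[of 0] by (auto simp: VC_def)
    define c where "c = max c0 1"
    have c: "f 0 \<omega> \<le> c * Z \<omega>" if "\<omega> \<in> \<Omega>" for \<omega>
    proof -
      have "f 0 \<omega> \<le> c0 * Z \<omega>" using c0 that by fastforce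
      also have "\<dots> \<le> c * Z \<omega>" using Z_ge1 that by (intro mult_right_mono) (auto simp: c_def intro: order_trans[of 0 1])
      finally show ?thesis .
    qed
    have c1: "c \<ge> 1" by (simp add: c_def)
    show "(\<lambda>n. L (f n)) \<longlonglongrightarrow> 0"
    proof (rule LIMSEQ_I)
      fix r :: real assume r: "0 < r"
      \<comment> \<open>The tail will enter with factor 2 c and so contributes less than r/2; the
        other half comes from Dini's theorem on K.\<close>
      have "r / (4 * c) > 0" using r c1 by simp
      then obtain z where z: "z \<ge> 0" "L (\<lambda>\<omega>. max (Z \<omega> - z) 0) < r / (4 * c)" using tail by blast
      \<comment> \<open>The factor 2 matters off K: there Z > 2 z, hence Z <= 2 (Z - z)^+, which
        turns the growth bound c Z into a multiple of the tail.\<close>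
      define K where "K = {\<omega>\<in>\<Omega>. Z \<omega> \<le> 2 * z}"
      have "\<exists>N. \<forall>n\<ge>N. \<forall>\<omega>\<in>K. f n \<omega> < r / 2"
      proof (rule dini_zero)
        show "compact K" unfolding K_def using Z_compact z(1) by simp
        show "continuous_on K (f n)" for n
          by (rule continuous_on_subset[OF VC_continuous[OF fV]]) (auto simp: K_def)
      qed (use dec lim r in \<open>auto simp: K_def\<close>)
      then obtain N where N: "\<And>n \<omega>. n \<ge> N \<Longrightarrow> \<omega> \<in> K \<Longrightarrow> f n \<omega> < r / 2" by blast
      have T: "(\<lambda>\<omega>. max (Z \<omega> - z) 0) \<in> VB" by (intro CB VC_max VC_intros VC_const VC_Z)
      have "norm (L (f n) - 0) < r" if n: "n \<ge> N" for n
      proof -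
        have "f n \<omega> \<le> r / 2 + 2 * c * max (Z \<omega> - z) 0" if w: "\<omega> \<in> \<Omega>" for \<omega>
        proof (cases "\<omega> \<in> K")
          case True
          have "0 \<le> 2 * c * max (Z \<omega> - z) 0" using c1 by simp
          then show ?thesis using N[OF n True] by linarith
        next
          case False
          then have "Z \<omega> > 2 * z" using w by (simp add: K_def)
          then have "Z \<omega> \<le> 2 * max (Z \<omega> - z) 0" using z(1) by (auto simp: max_def)
          then have "c * Z \<omega> \<le> c * (2 * max (Z \<omega> - z) 0)" using c1 by (intro mult_left_mono) auto
          moreover have "f n \<omega> \<le> f 0 \<omega>"
            by (rule lift_Suc_antimono_le[of "\<lambda>n. f n \<omega>", OF dec[OF w]]) simp
          ultimately show ?thesis using c[OF w] r by simp
        qed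
        then have "L (f n) \<le> L (\<lambda>\<omega>. r / 2 + 2 * c * max (Z \<omega> - z) 0)"
          by (intro L_mono CB[OF fV] VB_intros VB_const T) auto
        also have "\<dots> = r / 2 + 2 * c * L (\<lambda>\<omega>. max (Z \<omega> - z) 0)"
          using L_add[OF VB_const fun_subspace_scale[OF VB_subspace T], of "r / 2" "2 * c"]
            L_const[of "r / 2"] L_scale[OF T, of "2 * c"] by simp
        also have "\<dots> < r"
          using z(2) c1 by (simp add: field_simps)
        finally show ?thesis using Lf0[of n] by simp
      qed
      then show "\<exists>no. \<forall>n\<ge>no. norm (L (f n) - 0) < r" by blast
    qed
  qed
  then interpret D: daniell_functional \<Omega> Z L .
  show ?thesis
  proof (rule exI[of _ L], rule bexI[OF _ D.P_in_PZ], intro conjI ballI impI)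
    show "L Y - \<rho> Y \<le> L X - \<rho> X" if "Y \<in> VB" for Y by (rule subX[OF that])
    show "integral\<^sup>L D.P Y = L Y" if "Y \<in> VC" for Y by (rule D.integral_P[OF that])
    show "L X \<le> L Y" if "Y \<in> VB" "\<forall>\<omega>\<in>\<Omega>. X \<omega> \<le> Y \<omega>" for Y
      by (rule L_mono) (use that X in auto)
  qed
qed

text \<open>Fenchel's inequality: Y is one of the functions tested by \<open>phistar\<close>. If
  \<open>phistar\<close> is infinite, the left side is -\<infinity>.\<close>

lemma dual_le:
  assumes Q: "Q \<in> PZ \<Omega> Z" and Y: "Y \<in> VC"
  shows "ereal (integral\<^sup>L Q Y) - phistar \<Omega> Z A G Q \<le> \<phi> Y"
  using phistar_upper[OF Y Q] phi_rho[of Y] Y VC_subset_VB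
  by (cases "phistar \<Omega> Z A G Q") auto

lemma phistar_le:
  assumes Q: "Q \<in> PZ \<Omega> Z" and le: "\<And>Y. Y \<in> VC \<Longrightarrow> integral\<^sup>L Q Y - \<rho> Y \<le> r"
  shows "phistar \<Omega> Z A G Q \<le> ereal r"
  unfolding phistar_def
proof (rule SUP_least)
  fix Y assume "Y \<in> CZ \<Omega> Z"
  then have Y: "Y \<in> VC" by (rule CZ_VC)
  show "ereal (integral\<^sup>L Q Y) - \<phi> Y \<le> ereal r"
    using le[OF Y] phi_rho[of Y] Y VC_subset_VB by auto
qed

text \<open>The subgradient is taken on all of \<^term>\<open>VB\<close>: its restriction to \<^term>\<open>VC\<close> is an integral,
  and approximating X from above in \<^term>\<open>VC\<close> compares the two at X itself.\<close>

lemma dual_attained: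
  assumes X: "X \<in> UZ \<Omega> Z"
  shows "\<exists>Q\<in>PZ \<Omega> Z. \<phi> X \<le> ereal (integral\<^sup>L Q X) - phistar \<Omega> Z A G Q"
proof -
  have XB: "X \<in> VB" by (rule UZ_VB[OF X])
  obtain L Q where Q: "Q \<in> PZ \<Omega> Z" and sub: "\<And>Y. Y \<in> VB \<Longrightarrow> L Y - \<rho> Y \<le> L X - \<rho> X"
    and int: "\<And>Y. Y \<in> VC \<Longrightarrow> integral\<^sup>L Q Y = L Y"
    and mono: "\<And>Y. Y \<in> VB \<Longrightarrow> \<forall>\<omega>\<in>\<Omega>. X \<omega> \<le> Y \<omega> \<Longrightarrow> L X \<le> L Y"
    using subgradient_measure[OF XB] by blast
  obtain Y c where Y: "\<And>n. Y n \<in> VC" "\<And>n \<omega>. \<omega> \<in> \<Omega> \<Longrightarrow> X \<omega> \<le> Y n \<omega> \<and> \<bar>Y n \<omega>\<bar> \<le> c * Z \<omega>"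
    and lim: "\<And>\<omega>. \<omega> \<in> \<Omega> \<Longrightarrow> (\<lambda>n::nat. Y n \<omega>) \<longlonglongrightarrow> X \<omega>"
    using usc_approx[OF X] by blast
  have YB: "Y n \<in> VB" for n using Y(1) VC_subset_VB by blast
  have "(\<lambda>n. integral\<^sup>L Q (Y n)) \<longlonglongrightarrow> integral\<^sup>L Q X"
  proof (rule integral_dominated_convergence)
    show "X \<in> borel_measurable Q" "\<And>n. Y n \<in> borel_measurable Q"
      using VB_integrable[OF Q] XB YB by auto
    have "Z \<in> VB" using VC_Z VC_subset_VB by blast
    then show "integrable Q (\<lambda>\<omega>. c * Z \<omega>)" using VB_integrable[OF Q] by simp
    show "AE \<omega> in Q. (\<lambda>n. Y n \<omega>) \<longlonglongrightarrow> X \<omega>" using lim by (intro AE_I2) (simp add: PZ_D[OF Q])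
    show "AE \<omega> in Q. norm (Y n \<omega>) \<le> c * Z \<omega>" for n using Y(2) by (intro AE_I2) (simp add: PZ_D[OF Q])
  qed
  moreover have "L X \<le> integral\<^sup>L Q (Y n)" for n
    unfolding int[OF Y(1)] using Y(2) by (intro mono YB) blast
  ultimately have LX: "L X \<le> integral\<^sup>L Q X" by (intro LIMSEQ_le_const) auto
  \<comment> \<open>For continuous Y the integral of Y equals L Y, so optimality of L at X and
    \<open>L X \<le> integral\<^sup>L Q X\<close> chain to the required bound.\<close>
  have "phistar \<Omega> Z A G Q \<le> ereal (integral\<^sup>L Q X - \<rho> X)"
  proof (rule phistar_le[OF Q])
    fix Y assume "Y \<in> VC"
    then show "integral\<^sup>L Q Y - \<rho> Y \<le> integral\<^sup>L Q X - \<rho> X"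
      using sub[of Y] int[of Y] LX VC_subset_VB by auto
  qed
  then have "\<phi> X \<le> ereal (integral\<^sup>L Q X) - phistar \<Omega> Z A G Q"
    using phi_rho[OF XB] by (cases "phistar \<Omega> Z A G Q") auto
  then show ?thesis using Q by blast
qed

lemma dual_max_CZ:
  assumes X: "X \<in> CZ \<Omega> Z"
  shows "dual_max \<Omega> Z A G X"
proof -
  note le = dual_le[OF _ CZ_VC[OF X]]
  obtain Q where "Q \<in> PZ \<Omega> Z" "\<phi> X \<le> ereal (integral\<^sup>L Q X) - phistar \<Omega> Z A G Q"
    using dual_attained[OF CZ_UZ[OF X]] by blast
  then show ?thesis unfolding dual_max_def using le by (metis antisym)
qed

text \<open>X is not among the functions tested by \<open>phistar\<close>, so the upper bound is
  proved for each continuous majorant and passed to X through the infimum in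
  \<open>U\<close>.\<close>

lemma dual_max_UZ:
  assumes X: "X \<in> UZ \<Omega> Z"
    and U: "\<phi> X = (INF Y\<in>{Y\<in>CZ \<Omega> Z. \<forall>\<omega>\<in>\<Omega>. Y \<omega> \<ge> X \<omega>}. \<phi> Y)"
  shows "dual_max \<Omega> Z A G X"
proof -
  have le: "ereal (integral\<^sup>L Q X) - phistar \<Omega> Z A G Q \<le> \<phi> X" if Q: "Q \<in> PZ \<Omega> Z" for Q
    unfolding U
  proof (rule INF_greatest, safe)
    fix Y assume Y: "Y \<in> CZ \<Omega> Z" and XY: "\<forall>\<omega>\<in>\<Omega>. X \<omega> \<le> Y \<omega>"
    have YV: "Y \<in> VC" by (rule CZ_VC[OF Y])
    have "integral\<^sup>L Q X \<le> integral\<^sup>L Q Y"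
      by (rule integral_mono_VB[OF Q UZ_VB[OF X]]) (use YV VC_subset_VB XY in auto)
    then have "ereal (integral\<^sup>L Q X) - phistar \<Omega> Z A G Q \<le> ereal (integral\<^sup>L Q Y) - phistar \<Omega> Z A G Q"
      by (intro ereal_minus_mono) auto
    also have "\<dots> \<le> \<phi> Y" by (rule dual_le[OF Q YV])
    finally show "ereal (integral\<^sup>L Q X) - phistar \<Omega> Z A G Q \<le> \<phi> Y" .
  qed
  obtain Q where "Q \<in> PZ \<Omega> Z" "\<phi> X \<le> ereal (integral\<^sup>L Q X) - phistar \<Omega> Z A G Q"
    using dual_attained[OF X] by blast
  then show ?thesis unfolding dual_max_def using le by (metis antisym)
qed

end

section \<open>From dual measures back to the absence of arbitrage\<close>

context superhedging
begin

lemma zero_CZ: "cst \<Omega> 0 \<in> CZ \<Omega> Z"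
  unfolding cst_def by (rule VC_CZ[OF VC_const])

lemma phi_cst_0: "\<phi> (cst \<Omega> 0) = \<phi> (\<lambda>_. 0)"
  unfolding cst_def by (rule phi_restrict)

lemma phi_nonpos: "X \<in> setdiff \<Omega> G A \<Longrightarrow> \<phi> X \<le> 0"
  using phi_le[of 0 X] by (simp add: setdiff_GA_acceptable zero_ereal_def)

text \<open>A measure attaining the maximum at 0 has conjugate value 0. Under it every expectation
  is thus at most \<open>\<phi>\<close>, which is nonpositive on G - A. S stands for either
  \<open>CZ\<close> or \<open>UZ\<close>.\<close>

lemma dual_max_measure:
  assumes 0: "\<phi> (cst \<Omega> 0) = 0" and S: "cst \<Omega> 0 \<in> S" and dual: "\<forall>X\<in>S. dual_max \<Omega> Z A G X"
  shows "\<exists>Q\<in>PZ \<Omega> Z. \<forall>X\<in>S \<inter> setdiff \<Omega> G A. integral\<^sup>L Q X \<le> 0"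
proof -
  obtain Q where Q: "Q \<in> PZ \<Omega> Z"
    and eq: "\<phi> (cst \<Omega> 0) = ereal (integral\<^sup>L Q (cst \<Omega> 0)) - phistar \<Omega> Z A G Q"
    using dual S unfolding dual_max_def by blast
  have "integral\<^sup>L Q (cst \<Omega> 0) = 0" unfolding cst_def by (simp add: integral_restrict[OF Q])
  then have star: "phistar \<Omega> Z A G Q = 0" using eq 0 by (cases "phistar \<Omega> Z A G Q") auto
  have "integral\<^sup>L Q X \<le> 0" if X: "X \<in> S" "X \<in> setdiff \<Omega> G A" for X
  proof -
    have "ereal (integral\<^sup>L Q X) - phistar \<Omega> Z A G Q \<le> \<phi> X"
      using dual X(1) Q unfolding dual_max_def by blast
    also have "\<dots> \<le> 0" by (rule phi_nonpos[OF X(2)])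
    finally show ?thesis by (simp add: star)
  qed
  then show ?thesis using Q by blast
qed

text \<open>X need be neither semicontinuous nor bounded by a multiple of Z, so the hypothesis on Q
  cannot be applied to it directly. It applies to a minorant built from a compact set, which stays
  in G - A because that set is closed under passing to smaller measurable functions.\<close>

lemma usc_measure_no_positive:
  assumes Q: "Q \<in> PZ \<Omega> Z" and neg: "\<forall>X\<in>UZ \<Omega> Z \<inter> setdiff \<Omega> G A. integral\<^sup>L Q X \<le> 0"
    and X: "X \<in> setdiff \<Omega> G A"
  shows "\<not> (\<forall>\<omega>\<in>\<Omega>. X \<omega> > 0)"
proof
  assume pos: "\<forall>\<omega>\<in>\<Omega>. X \<omega> > 0"
  interpret Q: prob_space Q by (rule PZ_D[OF Q])
  have accX: "acceptable (\<lambda>\<omega>. - X \<omega>)" using X setdiff_GA_acceptable by simp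
  have XM: "X \<in> M" using acceptable_M[OF accX] by simp
  define B where "B n = {\<omega>\<in>\<Omega>. 1 / real (Suc n) < X \<omega>}" for n
  have "{\<omega> \<in> space (restrict_space borel \<Omega>). 1 / real (Suc n) < X \<omega>} \<in> sets (restrict_space borel \<Omega>)" for n
    using XM by measurable
  then have Br: "B n \<in> sets (restrict_space borel \<Omega>)" for n
    by (simp add: B_def space_restrict_space)
  have Bb: "B n \<in> sets borel" for n
    using Br[of n] Omega_borel by (subst (asm) sets_restrict_space_iff) auto
  have "(\<Union>n. B n) = \<Omega>"
  proof (safe; (simp add: B_def)?)
    fix \<omega> assume w: "\<omega> \<in> \<Omega>"
    with pos obtain n where "inverse (real (Suc n)) < X \<omega>" using reals_Archimedean by blast
    then show "\<exists>n. 1 / (1 + real n) < X \<omega>" by (auto simp: inverse_eq_divide)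
  qed
  then have "emeasure Q (\<Union>n. B n) = 1" using Q.emeasure_space_1 PZ_D[OF Q] by simp
  then obtain n where n: "emeasure Q (B n) \<noteq> 0"
    using emeasure_UN_eq_0[of Q B] Br PZ_D(2)[OF Q] by fastforce
  \<comment> \<open>Q lives on the Borel sets of \<open>\<Omega>\<close>; its image R lives on the
    ambient Polish space, where inner regularity is available.\<close>
  define R where "R = distr Q borel (\<lambda>\<omega>. \<omega>)"
  have id: "(\<lambda>\<omega>. \<omega>) \<in> Q \<rightarrow>\<^sub>M borel"
    using measurable_cong_sets[OF PZ_D(2)[OF Q] refl] measurable_restrict_space1[OF measurable_ident]
    by (auto simp: id_def)
  have RB: "emeasure R S = emeasure Q S" if "S \<in> sets borel" "S \<subseteq> \<Omega>" for S
    unfolding R_def by (subst emeasure_distr[OF id that(1)]) (use that(2) PZ_D[OF Q] in \<open>auto intro!: arg_cong[of _ _ "emeasure Q"]\<close>)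
  have BO: "B n \<subseteq> \<Omega>" by (auto simp: B_def)
  have setsR: "sets R = sets borel" by (simp add: R_def)
  interpret R: prob_space R unfolding R_def by (rule Q.prob_space_distr[OF id])
  have "emeasure R (B n) = (SUP K \<in> {K. K \<subseteq> B n \<and> compact K}. emeasure R K)"
    by (rule inner_regular[OF _ _ Bb]) (simp_all add: setsR)
  moreover have "0 < emeasure R (B n)" using RB[OF Bb BO] n by (simp add: zero_less_iff_neq_zero)
  ultimately obtain K where K: "K \<subseteq> B n" "compact K" "0 < emeasure R K"
    by (auto simp: less_SUP_iff)
  have KO: "K \<subseteq> \<Omega>" using K(1) BO by blast
  have Kb: "K \<in> sets borel" using K(2) by (rule borel_compact)
  have KQ: "0 < measure Q K" using K(3) RB[OF Kb KO] by (simp add: Q.emeasure_eq_measure)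
  \<comment> \<open>X exceeds q on K and is positive elsewhere, so q times the indicator of K lies
    below X.\<close>
  define q where "q = 1 / real (Suc n)"
  have q: "0 < q" "q \<le> 1" by (auto simp: q_def)
  define h where "h = (\<lambda>\<omega>. q * indicator K \<omega>)"
  have hM: "h \<in> M" unfolding h_def using Kb by (intro measurable_restrict_space1) simp
  have "\<bar>h \<omega>\<bar> \<le> 1 * Z \<omega>" if "\<omega> \<in> \<Omega>" for \<omega>
  proof -
    have "\<bar>h \<omega>\<bar> \<le> 1" using q by (auto simp: h_def indicator_def)
    then show ?thesis using Z_ge1 that by force
  qed
  then have hB: "h \<in> VB" using hM unfolding VB_def by blast
  have "openin (top_of_set \<Omega>) {\<omega>\<in>\<Omega>. restrict h \<Omega> \<omega> < c}" for c
  proof -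
    \<comment> \<open>The middle case carries the content: the sublevel set is
      \<open>\<Omega>\<close> without K, relatively open because a compact set is closed.\<close>
    have "{\<omega>\<in>\<Omega>. restrict h \<Omega> \<omega> < c} = (if c \<le> 0 then {} else if c \<le> q then \<Omega> \<inter> - K else \<Omega>)"
      using q by (auto simp: h_def indicator_def)
    then show ?thesis using compact_imp_closed[OF K(2)] by (simp add: openin_open_Int open_Compl)
  qed
  then have "restrict h \<Omega> \<in> UZ \<Omega> Z" using VB_BZ[OF hB] by (simp add: UZ_def usc_on_def)
  moreover have "restrict h \<Omega> \<in> setdiff \<Omega> G A"
    unfolding acceptable_uminus_iff
  proof (rule acceptable_mono[OF accX])
    show "(\<lambda>\<omega>. - h \<omega>) \<in> M" using hM by simp
    fix \<omega> assume w: "\<omega> \<in> \<Omega>"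
    have "h \<omega> \<le> X \<omega>"
      using K(1) pos w by (cases "\<omega> \<in> K") (auto simp: h_def B_def q_def less_imp_le)
    then show "- X \<omega> \<le> - h \<omega>" by simp
  qed
  ultimately have "integral\<^sup>L Q (restrict h \<Omega>) \<le> 0" using neg by blast
  moreover have "integral\<^sup>L Q (restrict h \<Omega>) = q * measure Q K"
    unfolding integral_restrict[OF Q] h_def using KO PZ_D[OF Q] by (simp add: Int_absorb2)
  ultimately show False using KQ q by (simp add: mult_le_0_iff)
qed

text \<open>An arbitrage X need not be continuous, but its constant lower bound \<epsilon> is, and
  it also lies in G - A.\<close>

lemma continuous_measure_no_arbitrage:
  assumes Q: "Q \<in> PZ \<Omega> Z" and neg: "\<forall>X\<in>CZ \<Omega> Z \<inter> setdiff \<Omega> G A. integral\<^sup>L Q X \<le> 0"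
  shows "\<not> (\<exists>X\<in>setdiff \<Omega> G A. \<exists>\<epsilon>::real. \<epsilon> > 0 \<and> (\<forall>\<omega>\<in>\<Omega>. X \<omega> \<ge> \<epsilon>))"
proof safe
  fix X \<epsilon> assume X: "X \<in> setdiff \<Omega> G A" and e: "0 < \<epsilon>" "\<forall>\<omega>\<in>\<Omega>. X \<omega> \<ge> \<epsilon>"
  interpret Q: prob_space Q by (rule PZ_D[OF Q])
  have "acceptable (\<lambda>\<omega>. - \<epsilon>)"
    by (rule acceptable_mono[of "\<lambda>\<omega>. - X \<omega>"]) (use X e setdiff_GA_acceptable in auto)
  then have "restrict (\<lambda>_. \<epsilon>) \<Omega> \<in> CZ \<Omega> Z \<inter> setdiff \<Omega> G A"
    using VC_CZ[OF VC_const] acceptable_uminus_iff[of "\<lambda>_. \<epsilon>"] by simp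
  then have "integral\<^sup>L Q (restrict (\<lambda>_. \<epsilon>) \<Omega>) \<le> 0" using neg by blast
  then show False using e(1) unfolding integral_restrict[OF Q] by (simp add: Q.prob_space)
qed

end

text \<open>A path is encoded as a vector indexed by pairs of component and date; \<open>k0\<close>
  marks the component required to be positive, so the first index type has J + 1 elements and the
  second has T.\<close>

theorem theorem2p1:
  fixes \<Omega> :: "(real^('k::finite \<times> 't::finite)) set"
    and k0 :: 'k
    and Z :: "real^('k \<times> 't) \<Rightarrow> real"
    and A G :: "(real^('k \<times> 't) \<Rightarrow> real) set"
  assumes Omega_ne: "\<Omega> \<noteq> {}"
    and Omega_sub: "\<forall>x\<in>\<Omega>. \<forall>t. x $ (k0, t) > 0"
    and Z_cont: "continuous_on \<Omega> Z"
    and Z_ge1: "\<forall>\<omega>\<in>\<Omega>. Z \<omega> \<ge> 1"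
    and Z_compact: "\<forall>z\<ge>0. compact {\<omega>\<in>\<Omega>. Z \<omega> \<le> z}"
    and G_sub: "G \<subseteq> Bset \<Omega>"
    and G_0: "cst \<Omega> 0 \<in> G"
    and A_sub: "A \<subseteq> Bset \<Omega>"
    and A_Bplus: "Bplus \<Omega> \<subseteq> A"
    and A_add: "setsum \<Omega> A (Bplus \<Omega>) \<subseteq> A"
    and AG_convex: "fconvex \<Omega> (setdiff \<Omega> A G)"
    and C: "\<forall>n::nat. n \<ge> 1 \<longrightarrow> (\<exists>z::real. z \<ge> 0 \<and>
              restrict (\<lambda>\<omega>. real n * max (Z \<omega> - z) 0 - 1 / real n) \<Omega> \<in> setdiff \<Omega> G A)"
  defines "cond_i \<equiv> \<not> (\<exists>X\<in>setdiff \<Omega> G A. \<exists>\<epsilon>::real. \<epsilon> > 0 \<and> (\<forall>\<omega>\<in>\<Omega>. X \<omega> \<ge> \<epsilon>))"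
    and "cond_ii \<equiv> (\<exists>P\<in>PZ \<Omega> Z. \<forall>X\<in>CZ \<Omega> Z \<inter> setdiff \<Omega> G A. integral\<^sup>L P X \<le> 0)"
    and "cond_iii \<equiv> (\<forall>X\<in>BZ \<Omega> Z. \<bar>phi \<Omega> A G X\<bar> \<noteq> \<infinity>) \<and> phi \<Omega> A G (cst \<Omega> 0) = 0
                     \<and> (\<forall>X\<in>CZ \<Omega> Z. dual_max \<Omega> Z A G X)"
    and "cond_U \<equiv> (\<forall>X\<in>UZ \<Omega> Z.
                     phi \<Omega> A G X = (INF Y\<in>{Y\<in>CZ \<Omega> Z. \<forall>\<omega>\<in>\<Omega>. Y \<omega> \<ge> X \<omega>}. phi \<Omega> A G Y))"
    and "cond_iv \<equiv> \<not> (\<exists>X\<in>setdiff \<Omega> G A. \<forall>\<omega>\<in>\<Omega>. X \<omega> > 0)"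
    and "cond_v \<equiv> (\<exists>P\<in>PZ \<Omega> Z. \<forall>X\<in>UZ \<Omega> Z \<inter> setdiff \<Omega> G A. integral\<^sup>L P X \<le> 0)"
    and "cond_vi \<equiv> (\<forall>X\<in>BZ \<Omega> Z. \<bar>phi \<Omega> A G X\<bar> \<noteq> \<infinity>) \<and> phi \<Omega> A G (cst \<Omega> 0) = 0
                     \<and> (\<forall>X\<in>UZ \<Omega> Z. dual_max \<Omega> Z A G X)"
  shows "(cond_i \<longleftrightarrow> cond_ii) \<and> (cond_i \<longleftrightarrow> cond_iii)
         \<and> (cond_U \<longrightarrow> (cond_i \<longleftrightarrow> cond_iv) \<and> (cond_i \<longleftrightarrow> cond_v) \<and> (cond_i \<longleftrightarrow> cond_vi))"
proof -
  interpret superhedging \<Omega> Z A G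
    by unfold_locales (fact Omega_ne Z_cont Z_ge1 Z_compact G_sub G_0 A_sub A_Bplus A_add AG_convex C)+
  have i_phi: "cond_i \<longleftrightarrow> phi \<Omega> A G (\<lambda>_. 0) = 0"
    unfolding cond_i_def by (rule no_arbitrage_iff)
  have na: "no_arbitrage \<Omega> Z A G" if cond_i
    by unfold_locales (use that i_phi in simp)
  have finite: "\<forall>X\<in>BZ \<Omega> Z. \<bar>phi \<Omega> A G X\<bar> \<noteq> \<infinity>" if cond_i
    by (intro ballI no_arbitrage.phi_finite[OF na[OF that]] BZ_VB)
  have cst: "phi \<Omega> A G (cst \<Omega> 0) = 0 \<longleftrightarrow> cond_i" using phi_cst_0 i_phi by simp
  have i_iii: cond_iii if cond_i
    unfolding cond_iii_def
  proof (intro conjI ballI)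
    show "dual_max \<Omega> Z A G X" if "X \<in> CZ \<Omega> Z" for X
      by (rule no_arbitrage.dual_max_CZ[OF na[OF \<open>cond_i\<close>] that])
  qed (use finite[OF that] cst that in auto)
  have i_vi: cond_vi if cond_i cond_U
    unfolding cond_vi_def
  proof (intro conjI ballI)
    show "dual_max \<Omega> Z A G X" if "X \<in> UZ \<Omega> Z" for X
      by (rule no_arbitrage.dual_max_UZ[OF na[OF \<open>cond_i\<close>] that])
        (rule \<open>cond_U\<close>[unfolded cond_U_def, rule_format, OF that])
  qed (use finite[OF that(1)] cst that(1) in auto)
  have iii_ii: cond_ii if cond_iii
    using that unfolding cond_iii_def cond_ii_def by (intro dual_max_measure zero_CZ) auto
  have vi_v: cond_v if cond_vi
    using that unfolding cond_vi_def cond_v_def by (intro dual_max_measure CZ_UZ[OF zero_CZ]) auto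
  have ii_i: cond_i if cond_ii
  proof -
    obtain Q where "Q \<in> PZ \<Omega> Z" "\<forall>X\<in>CZ \<Omega> Z \<inter> setdiff \<Omega> G A. integral\<^sup>L Q X \<le> 0"
      using \<open>cond_ii\<close> unfolding cond_ii_def by blast
    then show ?thesis unfolding cond_i_def by (rule continuous_measure_no_arbitrage)
  qed
  have v_iv: cond_iv if cond_v
  proof -
    obtain Q where "Q \<in> PZ \<Omega> Z" "\<forall>X\<in>UZ \<Omega> Z \<inter> setdiff \<Omega> G A. integral\<^sup>L Q X \<le> 0"
      using \<open>cond_v\<close> unfolding cond_v_def by blast
    then have "\<not> (\<forall>\<omega>\<in>\<Omega>. X \<omega> > 0)" if "X \<in> setdiff \<Omega> G A" for X
      by (rule usc_measure_no_positive[OF _ _ that])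
    then show ?thesis unfolding cond_iv_def by simp
  qed
  have iv_i: cond_i if cond_iv
    using that unfolding cond_iv_def cond_i_def by (meson less_le_trans)
  show ?thesis using i_iii iii_ii ii_i iv_i v_iv vi_v i_vi by blast
qed

end
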